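(* Let $(V^N,f_{MN})$ be a grading-restricted direct system of grading-restricted vertex algebras with graded vector space direct limit $V^\infty$ and homogeneous basis $\Phi$ of $V^\infty$, let $|0\rangle:=f_N(|0\rangle)\in V^\infty$ for some $N$, and assume that the limit $C^\infty_{abc}=\lim_{N\to\infty}C^N_{abc}$ of the structure constants exists for all $a,b,c\in\Phi$. Then $(V^\infty,|0\rangle,Y_\infty)$, with $$Y_\infty(b,z)c=\sum_{a\in\Phi}z^{\mathrm{wt}(a)-\mathrm{wt}(b)-\mathrm{wt}(c)}\,C^\infty_{abc}\,a\qquad(b,c\in\Phi)$$ extended linearly, is a grading-restricted vertex algebra.
   Context: All vector spaces are over $\mathbb{C}$. **Vertex algebra.** A vertex algebra $(V,|0\rangle,Y)$ is a vector space $V$ with a non-zero vector $|0\rangle$ and a linear map $Y:V\to \mathrm{End}(V)[[z,z^{-1}]]$, $a\mapsto Y(a,z)=\sum_{n\in\mathbb{Z}}a_nz^{-n-1}$, such that for all $a,v\in V$ one has $a_nv=0$ for $n$ large enough, and: (1) $Y(a,z)|0\rangle=a+O(z)$; (2) $Y(|0\rangle,z)=\mathbf 1_V$; (3) (Borcherds' identity) for all $a,b,c\in V$ and $k,m,n\in\mathbb{Z}$, $$\sum_{j\ge0}\binom mj(a_{n+j}b)_{m+k-j}c=\sum_{j\ge0}(-1)^j\binom nj a_{m+n-j}(b_{k+j}c)-\sum_{j\ge0}(-1)^{j+n}\binom nj b_{n+k-j}(a_{m+j}c).$$ **Grading-restricted vertex algebra.** A vertex algebra with a grading $V=\bigoplus_{n\in\mathbb{Z}}V_{(n)}$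 and the linear map $L(0)$ with $L(0)v=nv$ for $v\in V_{(n)}$ (write $\mathrm{wt}(v)=n$), such that $V_{(n)}=0$ for $n$ sufficiently negative, $\dim V_{(n)}<\infty$ for all $n$, and $[L(0),Y(v,z)]=z\frac{d}{dz}Y(v,z)+Y(L(0)v,z)$ for all $v\in V$. **Grading-restricted direct system.** A sequence $(V^N)_{N\in\mathbb{N}}$ of grading-restricted vertex algebras (with state-field maps $Y_N$) together with injective linear maps $f_{MN}:V^M\to V^N$ for $M\le N$ (not required to be vertex algebra homomorphisms) such that: (1) $f_{NK}\circ f_{MN}=f_{MK}$ for $M\le N\le K$; (2) $f_{NN}=\mathrm{id}$; (3) the $f_{MN}$ preserve the grading and the vacuum vector; (4) for each fixed $n\in\mathbb{Z}$, $\dim V^M_{(n)}=\dim V^N_{(n)}$ for all sufficiently large $M,N$; (5) there is $\bar n$ such that $V^N_{(n)}=0$ for all $n<\bar n$ for sufficiently large $N$. Its limit $V^\infty=\varinjlim V^N$ is the vector space direct limit, with canonical injective maps $f_N:V^N\to V^\infty$ satisfying $f_M=f_N\circ f_{MN}$, graded by $V^\infty_{(n)}=\bigcup_N f_N(V^N_{(n)})$. Every $u\in V^\infty$ is $f_N(u^N)$ for some $N$ and a unique $u^N\in V^N$, called the representative of $u$ in $V^N$ (representatives then exist for all larger $N$). **Structure constants.** $V^M_{(n)}$ is saturated if $\dim V^M_{(n)}=\dim V^N_{(n)}$ for all $N\geq M$. Let $\Phi=\bigcup_n\Phi_n$, where $\Phi_n=f_M(\Phi^M_n)$ for a basis $\Phi^M_n$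 of some saturated $V^M_{(n)}$; this is a homogeneous basis of $V^\infty$. For $a,b,c\in\Phi$ and $N$ large enough that $a,b,c$ have representatives $a^N,b^N,c^N$ and $V^N_{(\mathrm{wt}(a))}$ is saturated (so the representatives of the elements of $\Phi_{\mathrm{wt}(a)}$ form a basis of it), $C^N_{abc}\in\mathbb{C}$ is the coefficient of $a^N$ in $b^N_{\mathrm{wt}(c)+\mathrm{wt}(b)-\mathrm{wt}(a)-1}c^N$ with respect to this basis. *)

theory Defs
  imports Complex_Main "HOL-Library.Groups_Big_Fun"
begin

section \<open>Vertex algebras on subspaces of a complex vector space\<close>

text \<open>
  A sequence of vector spaces of varying dimension cannot be indexed by a sequence of types.
  Vector spaces are therefore subspaces of an ambient complex vector space, given by the
  library locale \<^locale>\<open>vector_space\<close>; any sequence of complex vector spaces can be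
  put in this form by passing to its direct sum.
\<close>

definition linear_on ::
  "(complex \<Rightarrow> 'a::ab_group_add \<Rightarrow> 'a) \<Rightarrow> (complex \<Rightarrow> 'b::ab_group_add \<Rightarrow> 'b)
    \<Rightarrow> 'a set \<Rightarrow> 'b set \<Rightarrow> ('a \<Rightarrow> 'b) \<Rightarrow> bool" where
  "linear_on s t V W g \<longleftrightarrow>
     g ` V \<subseteq> W \<and>
     (\<forall>x\<in>V. \<forall>y\<in>V. g (x + y) = g x + g y) \<and>
     (\<forall>c. \<forall>x\<in>V. g (s c x) = t c (g x))"

text \<open>
  \<open>state_field A a k\<close> is the endomorphism that is the coefficient of the power \<open>z\<^sup>k\<close>
  (not of \<open>z\<^sup>-\<^sup>k\<^sup>-\<^sup>1\<close>) in the formal series \<open>Y(a,z)\<close>.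
\<close>

record 'v vertex_structure =
  underlying :: "'v set"
  vacuum :: 'v
  state_field :: "'v \<Rightarrow> int \<Rightarrow> 'v \<Rightarrow> 'v"

text \<open>\<open>mode A a n\<close> is \<open>a\<^sub>n\<close>, where \<open>Y(a,z) = \<Sum>\<^sub>n a\<^sub>n z\<^sup>-\<^sup>n\<^sup>-\<^sup>1\<close>.\<close>

definition mode :: "('v, 'r) vertex_structure_scheme \<Rightarrow> 'v \<Rightarrow> int \<Rightarrow> 'v \<Rightarrow> 'v" where
  "mode A a n = state_field A a (- n - 1)"

text \<open>
  In Borcherds' identity all three sums are finite because of truncation; \<^const>\<open>Sum_any\<close>
  is the sum over the support.
\<close>

locale vertex_algebra = vector_space scale
  for scale :: "complex \<Rightarrow> 'v::ab_group_add \<Rightarrow> 'v" +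
  fixes A :: "('v, 'r) vertex_structure_scheme"
  assumes subspace_underlying: "subspace (underlying A)"
    and vacuum_in: "vacuum A \<in> underlying A"
    and vacuum_nonzero: "vacuum A \<noteq> 0"
    and state_field_endo:
      "a \<in> underlying A \<Longrightarrow>
        linear_on scale scale (underlying A) (underlying A) (state_field A a k)"
    and state_field_linear:
      "v \<in> underlying A \<Longrightarrow>
        linear_on scale scale (underlying A) (underlying A) (\<lambda>a. state_field A a k v)"
    and truncation:
      "a \<in> underlying A \<Longrightarrow> v \<in> underlying A \<Longrightarrow> \<exists>n0. \<forall>n\<ge>n0. mode A a n v = 0"
    and creation_constant: "a \<in> underlying A \<Longrightarrow> state_field A a 0 (vacuum A) = a"
    and creation_regular: "a \<in> underlying A \<Longrightarrow> k < 0 \<Longrightarrow> state_field A a k (vacuum A) = 0"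
    and vacuum_field:
      "v \<in> underlying A \<Longrightarrow> state_field A (vacuum A) k v = (if k = 0 then v else 0)"
    and Borcherds:
      "a \<in> underlying A \<Longrightarrow> b \<in> underlying A \<Longrightarrow> c \<in> underlying A \<Longrightarrow>
        Sum_any (\<lambda>j::nat. scale (of_int m gchoose j)
            (mode A (mode A a (n + int j) b) (m + k - int j) c))
        = Sum_any (\<lambda>j::nat. scale ((-1) ^ j * (of_int n gchoose j))
            (mode A a (m + n - int j) (mode A b (k + int j) c)))
        - Sum_any (\<lambda>j::nat. scale ((-1) powi (int j + n) * (of_int n gchoose j))
            (mode A b (n + k - int j) (mode A a (m + int j) c)))"


section \<open>Gradings\<close>

record 'v graded_vertex_structure = "'v vertex_structure" +
  weight_space :: "int \<Rightarrow> 'v set"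

definition homogeneous_decomposition ::
  "(int \<Rightarrow> 'v::ab_group_add set) \<Rightarrow> (int \<Rightarrow> 'v) \<Rightarrow> 'v \<Rightarrow> bool" where
  "homogeneous_decomposition H u v \<longleftrightarrow>
     (\<forall>n. u n \<in> H n) \<and> finite {n. u n \<noteq> 0} \<and> v = Sum_any u"

definition direct_sum_grading ::
  "(complex \<Rightarrow> 'v::ab_group_add \<Rightarrow> 'v) \<Rightarrow> 'v set \<Rightarrow> (int \<Rightarrow> 'v set) \<Rightarrow> bool" where
  "direct_sum_grading s V H \<longleftrightarrow>
     (\<forall>n. module.subspace s (H n) \<and> H n \<subseteq> V) \<and>
     (\<forall>v\<in>V. \<exists>!u. homogeneous_decomposition H u v)"

definition L0 ::
  "(complex \<Rightarrow> 'v::ab_group_add \<Rightarrow> 'v) \<Rightarrow> (int \<Rightarrow> 'v set) \<Rightarrow> 'v \<Rightarrow> 'v" where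
  "L0 s H v = Sum_any (\<lambda>n. s (of_int n) ((THE u. homogeneous_decomposition H u v) n))"

lemma L0_homogeneous:
  assumes "vector_space s" and "direct_sum_grading s V H" and v: "v \<in> H n"
  shows "L0 s H v = s (of_int n) v"
proof -
  interpret vector_space s by fact
  let ?u = "\<lambda>k. if k = n then v else 0"
  have supp: "{k. ?u k \<noteq> 0} \<subseteq> {n}" by auto
  have dec: "homogeneous_decomposition H ?u v"
    unfolding homogeneous_decomposition_def
  proof (intro conjI allI)
    show "?u k \<in> H k" for k
      using assms(2) v by (auto simp: direct_sum_grading_def subspace_0)
    show "finite {k. ?u k \<noteq> 0}" using supp finite_subset by blast
    show "v = Sum_any ?u"
      by (subst Sum_any.expand_superset[of "{n}"]) auto
  qed
  have "\<exists>!u. homogeneous_decomposition H u v"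
    using assms(2) v unfolding direct_sum_grading_def by blast
  then have "(THE u. homogeneous_decomposition H u v) = ?u"
    by (rule the1_equality[where P = "\<lambda>u. homogeneous_decomposition H u v"]) (rule dec)
  then show ?thesis
    unfolding L0_def by (subst Sum_any.expand_superset[of "{n}"]) auto
qed

locale grading_restricted_vertex_algebra = vertex_algebra scale A
  for scale :: "complex \<Rightarrow> 'v::ab_group_add \<Rightarrow> 'v"
    and A :: "('v, 'r) graded_vertex_structure_scheme" +
  assumes grading: "direct_sum_grading scale (underlying A) (weight_space A)"
    and bounded_below: "\<exists>n0. \<forall>n<n0. weight_space A n = {0}"
    and finite_dim: "\<exists>B. finite B \<and> span B = weight_space A n"
    \<comment> \<open>the coefficient of \<open>z\<^sup>k\<close> in \<open>[L(0), Y(v,z)] w = z (d/dz) Y(v,z) w + Y(L(0)v,z) w\<close>\<close>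
    and L0_commutator:
      "v \<in> underlying A \<Longrightarrow> w \<in> underlying A \<Longrightarrow>
        L0 scale (weight_space A) (state_field A v k w)
          - state_field A v k (L0 scale (weight_space A) w)
        = scale (of_int k) (state_field A v k w)
          + state_field A (L0 scale (weight_space A) v) k w"


section \<open>Direct systems and their limits\<close>

locale grading_restricted_direct_system = vector_space scale
  for scale :: "complex \<Rightarrow> 'v::ab_group_add \<Rightarrow> 'v" +
  fixes A :: "nat \<Rightarrow> 'v graded_vertex_structure"
    and f :: "nat \<Rightarrow> nat \<Rightarrow> 'v \<Rightarrow> 'v"
  assumes algebras: "grading_restricted_vertex_algebra scale (A N)"
    and f_linear:
      "M \<le> N \<Longrightarrow> linear_on scale scale (underlying (A M)) (underlying (A N)) (f M N)"
    and f_inj: "M \<le> N \<Longrightarrow> inj_on (f M N) (underlying (A M))"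
    and f_comp:
      "M \<le> N \<Longrightarrow> N \<le> K \<Longrightarrow> u \<in> underlying (A M) \<Longrightarrow> f N K (f M N u) = f M K u"
    and f_id: "u \<in> underlying (A N) \<Longrightarrow> f N N u = u"
    and f_grading: "M \<le> N \<Longrightarrow> f M N ` weight_space (A M) n \<subseteq> weight_space (A N) n"
    and f_vacuum: "M \<le> N \<Longrightarrow> f M N (vacuum (A M)) = vacuum (A N)"
    and dim_stable:
      "\<exists>K. \<forall>M\<ge>K. \<forall>N\<ge>K. dim (weight_space (A M) n) = dim (weight_space (A N) n)"
    and uniformly_bounded_below:
      "\<exists>nbar. \<exists>K. \<forall>N\<ge>K. \<forall>n<nbar. weight_space (A N) n = {0}"

text \<open>
  The direct limit of a system of vector spaces, as the quotient of the disjoint union of the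
  \<open>V N\<close> by eventual equality, is \<open>W\<close> with canonical maps \<open>\<phi> N\<close>: every element of
  \<open>W\<close> is the class of some \<open>u \<in> V N\<close>, and two classes agree only if their representatives
  become equal at some later stage. The universal property is proved below.
\<close>

locale direct_limit = source: vector_space s + target: vector_space t
  for s :: "complex \<Rightarrow> 'v::ab_group_add \<Rightarrow> 'v"
    and t :: "complex \<Rightarrow> 'w::ab_group_add \<Rightarrow> 'w" +
  fixes V :: "nat \<Rightarrow> 'v set"
    and f :: "nat \<Rightarrow> nat \<Rightarrow> 'v \<Rightarrow> 'v"
    and W :: "'w set"
    and \<phi> :: "nat \<Rightarrow> 'v \<Rightarrow> 'w"
  assumes subspace_limit: "target.subspace W"
    and canonical_linear: "linear_on s t (V N) W (\<phi> N)"
    and canonical_compatible: "M \<le> N \<Longrightarrow> u \<in> V M \<Longrightarrow> \<phi> N (f M N u) = \<phi> M u"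
    and canonical_covers: "W = (\<Union>N. \<phi> N ` V N)"
    and canonical_eq:
      "u \<in> V M \<Longrightarrow> v \<in> V N \<Longrightarrow> \<phi> M u = \<phi> N v \<Longrightarrow> \<exists>K\<ge>max M N. f M K u = f N K v"

lemma direct_limit_universal:
  fixes r :: "complex \<Rightarrow> 'u::ab_group_add \<Rightarrow> 'u"
  assumes "direct_limit s t V f W \<phi>"
    and f: "\<And>M N. M \<le> N \<Longrightarrow> linear_on s s (V M) (V N) (f M N)"
    and V: "\<And>N. module.subspace s (V N)"
    and g: "\<And>N. linear_on s r (V N) U (g N)"
    and compatible: "\<And>M N u. M \<le> N \<Longrightarrow> u \<in> V M \<Longrightarrow> g N (f M N u) = g M u"
  shows "\<exists>h. linear_on t r W U h \<and> (\<forall>N. \<forall>u\<in>V N. h (\<phi> N u) = g N u) \<and>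
           (\<forall>h'. (\<forall>N. \<forall>u\<in>V N. h' (\<phi> N u) = g N u) \<longrightarrow> (\<forall>w\<in>W. h' w = h w))"
proof -
  interpret direct_limit s t V f W \<phi> by fact
  have eq: "g M u = g N v" if "u \<in> V M" "v \<in> V N" "\<phi> M u = \<phi> N v" for M N u v
    using canonical_eq[OF that] compatible that by (metis max.bounded_iff)
  define h where "h w = (THE y. \<exists>N. \<exists>u\<in>V N. w = \<phi> N u \<and> y = g N u)" for w
  have h: "h (\<phi> N u) = g N u" if "u \<in> V N" for N u
    unfolding h_def
  proof (rule the_equality)
    show "\<exists>M. \<exists>v\<in>V M. \<phi> N u = \<phi> M v \<and> g N u = g M v" using that by blast
    show "y = g N u" if "\<exists>M. \<exists>v\<in>V M. \<phi> N u = \<phi> M v \<and> y = g M v" for y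
      using that eq[OF \<open>u \<in> V N\<close>] by metis
  qed
  have common: "\<exists>N. \<exists>u\<in>V N. \<exists>v\<in>V N. x = \<phi> N u \<and> y = \<phi> N v" if "x \<in> W" "y \<in> W" for x y
  proof -
    obtain M u N v where *: "u \<in> V M" "x = \<phi> M u" "v \<in> V N" "y = \<phi> N v"
      using \<open>x \<in> W\<close> \<open>y \<in> W\<close> canonical_covers by blast
    let ?K = "max M N"
    have "f M ?K u \<in> V ?K" "f N ?K v \<in> V ?K"
      using f[of M ?K] f[of N ?K] * unfolding linear_on_def by auto
    moreover have "x = \<phi> ?K (f M ?K u)" "y = \<phi> ?K (f N ?K v)"
      using canonical_compatible * by auto
    ultimately show ?thesis by blast
  qed
  have "linear_on t r W U h"
    unfolding linear_on_def
  proof (intro conjI ballI allI)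
    show "h ` W \<subseteq> U"
      using canonical_covers h g unfolding linear_on_def by (auto simp: image_subset_iff)
  next
    fix x y assume "x \<in> W" "y \<in> W"
    then obtain N u v where *: "u \<in> V N" "v \<in> V N" "x = \<phi> N u" "y = \<phi> N v"
      using common by blast
    moreover have "u + v \<in> V N"
      using V * source.subspace_add by blast
    moreover have "x + y = \<phi> N (u + v)"
      using canonical_linear[of N] * unfolding linear_on_def by auto
    ultimately show "h (x + y) = h x + h y"
      using h g[of N] unfolding linear_on_def by auto
  next
    fix c x assume "x \<in> W"
    then obtain N u where *: "u \<in> V N" "x = \<phi> N u"
      using canonical_covers by blast
    moreover have "s c u \<in> V N"
      using V * source.subspace_scale by blast
    moreover have "t c x = \<phi> N (s c u)"
      using canonical_linear[of N] * unfolding linear_on_def by auto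
    ultimately show "h (t c x) = r c (h x)"
      using h g[of N] unfolding linear_on_def by auto
  qed
  moreover have "\<forall>w\<in>W. h' w = h w" if "\<forall>N. \<forall>u\<in>V N. h' (\<phi> N u) = g N u" for h'
    using that h canonical_covers by auto
  ultimately show ?thesis using h by blast
qed

definition limit_weight_space ::
  "(nat \<Rightarrow> ('v, 'r) graded_vertex_structure_scheme) \<Rightarrow> (nat \<Rightarrow> 'v \<Rightarrow> 'w) \<Rightarrow> int \<Rightarrow> 'w set" where
  "limit_weight_space A \<phi> n = (\<Union>N. \<phi> N ` weight_space (A N) n)"

definition representative ::
  "(nat \<Rightarrow> ('v, 'r) graded_vertex_structure_scheme) \<Rightarrow> (nat \<Rightarrow> 'v \<Rightarrow> 'w) \<Rightarrow> nat \<Rightarrow> 'w \<Rightarrow> 'v" where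
  "representative A \<phi> N u = (THE x. x \<in> underlying (A N) \<and> \<phi> N x = u)"


section \<open>Structure constants\<close>

definition saturated ::
  "(complex \<Rightarrow> 'v::ab_group_add \<Rightarrow> 'v) \<Rightarrow> (nat \<Rightarrow> ('v, 'r) graded_vertex_structure_scheme)
    \<Rightarrow> nat \<Rightarrow> int \<Rightarrow> bool" where
  "saturated s A M n \<longleftrightarrow>
     (\<forall>N\<ge>M. vector_space.dim s (weight_space (A M) n) = vector_space.dim s (weight_space (A N) n))"

text \<open>\<open>\<Phi> n\<close> is the part of weight \<open>n\<close> of the homogeneous basis \<open>\<Union>n. \<Phi> n\<close>.\<close>

definition homogeneous_limit_basis ::
  "(complex \<Rightarrow> 'v::ab_group_add \<Rightarrow> 'v) \<Rightarrow> (nat \<Rightarrow> ('v, 'r) graded_vertex_structure_scheme)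
    \<Rightarrow> (nat \<Rightarrow> 'v \<Rightarrow> 'w) \<Rightarrow> (int \<Rightarrow> 'w set) \<Rightarrow> bool" where
  "homogeneous_limit_basis s A \<phi> \<Phi> \<longleftrightarrow>
     (\<forall>n. \<exists>M B. saturated s A M n \<and>
        \<not> module.dependent s B \<and> module.span s B = weight_space (A M) n \<and>
        \<Phi> n = \<phi> M ` B)"

definition wt :: "(int \<Rightarrow> 'v set) \<Rightarrow> 'v \<Rightarrow> int" where
  "wt H v = (THE n. v \<in> H n)"

text \<open>
  \<open>structure_constant s A \<phi> \<Phi> N a b c\<close> is the coefficient of \<open>a\<close> in the product of \<open>b\<close> and
  \<open>c\<close>, all taken in \<open>A N\<close>. It is meaningful only for \<open>N\<close> so large that the representatives
  exist and the weight space of \<open>a\<close> is saturated; only its limit is used.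
\<close>

definition structure_constant ::
  "(complex \<Rightarrow> 'v::ab_group_add \<Rightarrow> 'v) \<Rightarrow> (nat \<Rightarrow> ('v, 'r) graded_vertex_structure_scheme)
    \<Rightarrow> (nat \<Rightarrow> 'v \<Rightarrow> 'w) \<Rightarrow> (int \<Rightarrow> 'w set) \<Rightarrow> nat \<Rightarrow> 'w \<Rightarrow> 'w \<Rightarrow> 'w \<Rightarrow> complex" where
  "structure_constant s A \<phi> \<Phi> N a b c =
     (let w = wt (limit_weight_space A \<phi>); rep = representative A \<phi> N in
      module.representation s (rep ` \<Phi> (w a))
        (mode (A N) (rep b) (w c + w b - w a - 1) (rep c)) (rep a))"

definition limit_structure_constant ::
  "(complex \<Rightarrow> 'v::ab_group_add \<Rightarrow> 'v) \<Rightarrow> (nat \<Rightarrow> ('v, 'r) graded_vertex_structure_scheme)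
    \<Rightarrow> (nat \<Rightarrow> 'v \<Rightarrow> 'w) \<Rightarrow> (int \<Rightarrow> 'w set) \<Rightarrow> 'w \<Rightarrow> 'w \<Rightarrow> 'w \<Rightarrow> complex" where
  "limit_structure_constant s A \<phi> \<Phi> a b c = lim (\<lambda>N. structure_constant s A \<phi> \<Phi> N a b c)"

text \<open>
  The coefficient of \<open>z\<^sup>k\<close> in \<open>Y\<^sub>\<infinity>(b,z)c\<close>, first for basis vectors and then extended
  linearly in both arguments.
\<close>

definition limit_field_basis ::
  "(complex \<Rightarrow> 'v::ab_group_add \<Rightarrow> 'v) \<Rightarrow> (complex \<Rightarrow> 'w::ab_group_add \<Rightarrow> 'w)
    \<Rightarrow> (nat \<Rightarrow> ('v, 'r) graded_vertex_structure_scheme)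
    \<Rightarrow> (nat \<Rightarrow> 'v \<Rightarrow> 'w) \<Rightarrow> (int \<Rightarrow> 'w set) \<Rightarrow> 'w \<Rightarrow> int \<Rightarrow> 'w \<Rightarrow> 'w" where
  "limit_field_basis s t A \<phi> \<Phi> b k c =
     (let w = wt (limit_weight_space A \<phi>) in
      \<Sum>a\<in>{a \<in> (\<Union>n. \<Phi> n). w a - w b - w c = k}. t (limit_structure_constant s A \<phi> \<Phi> a b c) a)"

definition limit_field ::
  "(complex \<Rightarrow> 'v::ab_group_add \<Rightarrow> 'v) \<Rightarrow> (complex \<Rightarrow> 'w::ab_group_add \<Rightarrow> 'w)
    \<Rightarrow> (nat \<Rightarrow> ('v, 'r) graded_vertex_structure_scheme)
    \<Rightarrow> (nat \<Rightarrow> 'v \<Rightarrow> 'w) \<Rightarrow> (int \<Rightarrow> 'w set) \<Rightarrow> 'w \<Rightarrow> int \<Rightarrow> 'w \<Rightarrow> 'w" where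
  "limit_field s t A \<phi> \<Phi> u k v =
     vector_space_pair.construct t t (\<Union>n. \<Phi> n)
       (\<lambda>b. vector_space_pair.construct t t (\<Union>n. \<Phi> n)
          (\<lambda>c. limit_field_basis s t A \<phi> \<Phi> b k c) v) u"

end

theory Submission
  imports Defs
begin

text \<open>
  The axioms of a vertex algebra pass to the limit because each of them, once its arguments are
  fixed, is an identity between finitely many products, and because products are continuous.
  Three observations make this precise.

  The canonical map \<open>\<phi> N\<close> is injective and linear, so \<open>V\<^sup>N\<close> may be replaced by its image: the
  limit \<open>V\<^sup>\<infinity>\<close> is then the union of an increasing sequence of subspaces, the \<open>N\<close>-th of which is a
  graded vertex algebra in its own right. Nothing relates the products at different \<open>N\<close>; the
  vacuum and the grading are shared. The dimension condition says that in each weight the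
  sequence is eventually constant, so a weight space of \<open>V\<^sup>\<infinity>\<close> is a weight space of \<open>V\<^sup>N\<close> for all
  large \<open>N\<close>.

  A sequence in \<open>V\<^sup>\<infinity>\<close> is called convergent if it eventually stays in the span of finitely many basis
  vectors and converges in coordinates. In these terms the hypothesis on the structure constants
  says that \<open>b\<^sub>n c\<close>, computed in \<open>V\<^sup>N\<close>, converges to \<open>b\<^sub>n c\<close> computed in \<open>V\<^sup>\<infinity>\<close> for basis vectors
  \<open>b\<close>, \<open>c\<close>. Since everything takes place in finite-dimensional spaces, bilinearity improves this
  to joint continuity: if \<open>x\<^sub>N\<close> converges to \<open>x\<close> and \<open>z\<^sub>N\<close> to \<open>z\<close>, then the products of \<open>x\<^sub>N\<close> and
  \<open>z\<^sub>N\<close> in \<open>V\<^sup>N\<close> converge to the product of \<open>x\<close> and \<open>z\<close> (\<open>converges_product\<close>). The iterated products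
  of Borcherds' identity therefore converge as well.

  Finally, truncation is uniform in \<open>N\<close> (\<open>uniform_truncation\<close>): a homogeneous product \<open>u\<^sub>n v\<close> has
  weight \<open>wt(u) + wt(v) - n - 1\<close>, and the weights are bounded below by a bound common to all large
  \<open>N\<close>. Hence the three sums in Borcherds' identity have, for all large \<open>N\<close> and in the limit, the
  same finite range of summation, and the limit of the identities is the identity of the limits
  (\<open>limit_Borcherds\<close>).

  The \<open>L(0)\<close>-commutator formula is never passed to the limit. It is equivalent to the statement that
  the coefficient of \<open>z\<^sup>k\<close> in \<open>Y(u,z)v\<close> has weight \<open>wt(u) + wt(v) + k\<close>, and that statement is
  preserved because weight spaces are closed under limits.
\<close>

section \<open>Linear algebra on subspaces\<close>

lemma linear_on_in: "linear_on s t V W g \<Longrightarrow> x \<in> V \<Longrightarrow> g x \<in> W"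
  and linear_on_add: "linear_on s t V W g \<Longrightarrow> x \<in> V \<Longrightarrow> y \<in> V \<Longrightarrow> g (x + y) = g x + g y"
  and linear_on_scale: "linear_on s t V W g \<Longrightarrow> x \<in> V \<Longrightarrow> g (s c x) = t c (g x)"
  unfolding linear_on_def by auto

lemma linear_on_zero:
  assumes "linear_on s t V W g" "0 \<in> V"
  shows "g 0 = 0"
  using linear_on_add[OF assms(1), of 0 0] assms(2) by simp

lemma linear_on_sum:
  assumes "vector_space s" "linear_on s t V W g" "module.subspace s V"
    and "\<And>i. i \<in> I \<Longrightarrow> x i \<in> V"
  shows "g (\<Sum>i\<in>I. x i) = (\<Sum>i\<in>I. g (x i))"
proof -
  interpret vector_space s by fact
  note V = assms(3)
  show ?thesis
    using assms(4)
    by (induction I rule: infinite_finite_induct)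
      (auto simp: linear_on_zero[OF assms(2)] linear_on_add[OF assms(2)] V subspace_0 subspace_sum)
qed

lemma linear_on_diff:
  assumes "vector_space s" "linear_on s t V W g" "module.subspace s V" "x \<in> V" "y \<in> V"
  shows "g (x - y) = g x - g y"
proof -
  interpret vector_space s by fact
  have "g (x - y) + g y = g x"
    using linear_on_add[OF assms(2) _ assms(5), of "x - y"] assms by (simp add: subspace_diff)
  then show ?thesis by (simp add: eq_diff_eq)
qed

text \<open>
  Reduces the behaviour of spans and of independent sets under a map given on a subspace to
  that under a linear map of the whole space.
\<close>

lemma linear_on_extends_to_linear:
  assumes "vector_space s" "vector_space t" "linear_on s t V W g" "module.subspace s V"
  obtains h where "Vector_Spaces.linear s t h" "\<And>x. x \<in> V \<Longrightarrow> h x = g x"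
proof -
  interpret vector_space_pair s t
    using assms by (simp add: vector_space_pair_def)
  obtain B where B: "B \<subseteq> V" "vs1.independent B" "V \<subseteq> vs1.span B"
    using vs1.maximal_independent_subset by blast
  interpret h: Vector_Spaces.linear s t "construct B g"
    by (rule linear_construct) fact
  have span: "vs1.span B = V"
    using B vs1.span_minimal[OF B(1) assms(4)] by blast
  have "x \<in> V \<and> construct B g x = g x" if "x \<in> vs1.span B" for x
    using that
  proof (induction rule: vs1.span_induct_alt)
    case base
    then show ?case
      using assms(4) linear_on_zero[OF assms(3)] by (auto simp: vs1.subspace_0)
  next
    case (step c x y)
    then have V: "x \<in> V" "s c x \<in> V" "y \<in> V"
      using B(1) assms(4) by (auto simp: vs1.subspace_scale)
    have "construct B g (s c x + y) = t c (g x) + g y"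
      using step B(2) by (simp add: h.add h.scale construct_basis)
    also have "\<dots> = g (s c x + y)"
      using V by (simp add: linear_on_add[OF assms(3)] linear_on_scale[OF assms(3)])
    finally show ?case
      using V assms(4) by (simp add: vs1.subspace_add)
  qed
  then show thesis
    using that[OF h.linear_axioms] span by blast
qed

context vector_space
begin

lemma subspace_span_induct [consumes 1, case_names base zero scale_add]:
  assumes "x \<in> span B" "\<And>b. b \<in> B \<Longrightarrow> P b" and "P 0"
    and "\<And>c x y. x \<in> span B \<Longrightarrow> y \<in> span B \<Longrightarrow> P x \<Longrightarrow> P y \<Longrightarrow> P (c *s x + y)"
  shows "P x"
proof -
  have "x \<in> span B \<and> P x"
    using assms(1)
    by (induction rule: span_induct_alt)
      (auto simp: span_zero assms(2,3) span_base span_add span_scale intro!: assms(4))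
  then show ?thesis ..
qed

text \<open>
  The coordinates are those with respect to the full basis \<open>E\<close>: later the finite set \<open>B\<close>
  varies with the vector while the coordinate functions have to stay the same.
\<close>

lemma sum_representation_on_subset:
  assumes "independent E" "B \<subseteq> E" "finite B" "x \<in> span B"
  shows "x = (\<Sum>b\<in>B. representation E x b *s b)"
  using sum_representation_eq[of B x B] representation_extend[of E x B] independent_mono[of E B] assms
  by simp

lemma representation_sum_scale:
  assumes "independent B" "finite B" "a \<in> B"
  shows "representation B (\<Sum>b\<in>B. c b *s b) a = c a"
proof -
  have "representation B (\<Sum>b\<in>B. c b *s b) a = (\<Sum>b\<in>B. representation B (c b *s b) a)"
    using assms by (subst representation_sum) (auto intro: span_scale span_base)
  also have "\<dots> = (\<Sum>b\<in>B. if a = b then c b else 0)"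
    using assms by (intro sum.cong) (auto simp: representation_scale span_base representation_basis)
  also have "\<dots> = c a" using assms by simp
  finally show ?thesis .
qed

lemma span_support:
  assumes "independent E" "x \<in> span E" "\<And>b. representation E x b \<noteq> 0 \<Longrightarrow> b \<in> B"
  shows "x \<in> span B"
proof -
  have "(\<Sum>b | representation E x b \<noteq> 0. representation E x b *s b) \<in> span B"
    using assms(3) by (intro span_sum span_scale span_base) simp
  then show ?thesis
    using sum_nonzero_representation_eq[OF assms(1,2)] by simp
qed

text \<open>
  The ambient space may be infinite-dimensional, so the dimension count takes place inside the
  finite-dimensional space \<open>span D\<close>.
\<close>

lemma independent_full_cardinality_spans:
  assumes D: "finite D" "independent D" and C: "independent C" "C \<subseteq> span D" "card C = card D"
  shows "span C = span D"
proof
  show "span C \<subseteq> span D"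
    using C(2) by (simp add: span_minimal)
  show "span D \<subseteq> span C"
  proof (rule ccontr)
    assume "\<not> span D \<subseteq> span C"
    then obtain w where w: "w \<in> span D" "w \<notin> span C" by blast
    have "insert w C \<subseteq> span D" using w C by blast
    from independent_span_bound[OF D(1) independent_insertI[OF w(2) C(1)] this]
    have fin: "finite (insert w C)" and card: "card (insert w C) \<le> card D" by auto
    have "w \<notin> C" using w(2) span_base by blast
    then have "card (insert w C) = Suc (card C)" using fin by simp
    then show False using card C(3) by simp
  qed
qed

end

locale complex_vector_space = vector_space scale
  for scale :: "complex \<Rightarrow> 'v::ab_group_add \<Rightarrow> 'v" (infixr "*s" 75)
begin

text \<open>
  Will be used for all products at once: \<open>B\<close> and \<open>C\<close> stay the same while the product \<open>G\<close>
  and the vectors \<open>x\<close>, \<open>y\<close> run through a sequence.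
\<close>

lemma bilinear_expansion:
  assumes U: "subspace U" and E: "independent E"
    and right: "\<And>u. u \<in> U \<Longrightarrow> linear_on scale scale U W (G u)"
    and left: "\<And>v. v \<in> U \<Longrightarrow> linear_on scale scale U W (\<lambda>u. G u v)"
    and B: "finite B" "B \<subseteq> E" "B \<subseteq> U" and C: "finite C" "C \<subseteq> E" "C \<subseteq> U"
    and x: "x \<in> span B" and y: "y \<in> span C"
  shows "G x y = (\<Sum>b\<in>B. \<Sum>c\<in>C. (representation E x b * representation E y c) *s G b c)"
proof -
  let ?r = "representation E"
  note VS = vector_space_axioms
  have in_U: "?r x b *s b \<in> U" if "b \<in> B" for b using that B U by (auto intro: subspace_scale)
  have in_U': "?r y c *s c \<in> U" if "c \<in> C" for c using that C U by (auto intro: subspace_scale)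
  have yU: "y \<in> U" using y C span_minimal[OF _ U] by blast
  have "G x y = G (\<Sum>b\<in>B. ?r x b *s b) y"
    using sum_representation_on_subset[OF E B(2,1) x] by simp
  also have "\<dots> = (\<Sum>b\<in>B. G (?r x b *s b) y)"
    by (rule linear_on_sum[OF VS left[OF yU] U in_U])
  also have "\<dots> = (\<Sum>b\<in>B. ?r x b *s G b y)"
    using B by (intro sum.cong) (auto simp: linear_on_scale[OF left[OF yU]])
  also have "\<dots> = (\<Sum>b\<in>B. \<Sum>c\<in>C. (?r x b * ?r y c) *s G b c)"
  proof (rule sum.cong[OF refl])
    fix b assume "b \<in> B"
    then have b: "b \<in> U" using B by blast
    have "G b y = G b (\<Sum>c\<in>C. ?r y c *s c)"
      using sum_representation_on_subset[OF E C(2,1) y] by simp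
    also have "\<dots> = (\<Sum>c\<in>C. G b (?r y c *s c))"
      by (rule linear_on_sum[OF VS right[OF b] U in_U'])
    also have "\<dots> = (\<Sum>c\<in>C. ?r y c *s G b c)"
      using C by (intro sum.cong) (auto simp: linear_on_scale[OF right[OF b]])
    finally show "?r x b *s G b y = (\<Sum>c\<in>C. (?r x b * ?r y c) *s G b c)"
      by (simp add: scale_sum_right)
  qed
  finally show ?thesis .
qed

end

section \<open>Gradings and the operator \<open>L(0)\<close>\<close>

context complex_vector_space
begin

lemma grading_subspace: "direct_sum_grading scale V H \<Longrightarrow> subspace (H n)"
  and grading_subset: "direct_sum_grading scale V H \<Longrightarrow> H n \<subseteq> V"
  and grading_decomposition:
    "direct_sum_grading scale V H \<Longrightarrow> v \<in> V \<Longrightarrow> \<exists>u. homogeneous_decomposition H u v"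
  and grading_decomposition_unique:
    "direct_sum_grading scale V H \<Longrightarrow> v \<in> V \<Longrightarrow>
      homogeneous_decomposition H u v \<Longrightarrow> homogeneous_decomposition H u' v \<Longrightarrow> u = u'"
  unfolding direct_sum_grading_def by blast+

lemma homogeneous_decomposition_sum:
  "homogeneous_decomposition H u v \<Longrightarrow> v = (\<Sum>n | u n \<noteq> 0. u n)"
  unfolding homogeneous_decomposition_def by (simp add: Sum_any.expand_set)

text \<open>
  Independence of the weight spaces: the vector \<open>0\<close> also has the decomposition with all
  components zero, and decompositions are unique.
\<close>

lemma homogeneous_sum_eq_0:
  assumes G: "direct_sum_grading scale V H" and "subspace V"
    and I: "finite I" and u: "\<And>n. n \<in> I \<Longrightarrow> u n \<in> H n" and "(\<Sum>n\<in>I. u n) = 0" and "n \<in> I"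
  shows "u n = 0"
proof -
  let ?u = "\<lambda>n. if n \<in> I then u n else 0"
  have "{n. ?u n \<noteq> 0} \<subseteq> I" by auto
  then have "homogeneous_decomposition H ?u 0"
    unfolding homogeneous_decomposition_def using assms grading_subspace[OF G]
    by (auto simp: subspace_0 Sum_any.expand_superset[of I] intro: finite_subset)
  moreover have "homogeneous_decomposition H (\<lambda>n. 0) 0"
    unfolding homogeneous_decomposition_def using grading_subspace[OF G] by (auto simp: subspace_0)
  ultimately have "?u = (\<lambda>n. 0)"
    using grading_decomposition_unique[OF G, of 0] \<open>subspace V\<close> by (simp add: subspace_0)
  from fun_cong[OF this, of n] show ?thesis
    using \<open>n \<in> I\<close> by simp
qed

lemma weight_unique:
  assumes G: "direct_sum_grading scale V H" and "subspace V"
    and "v \<in> H m" "v \<in> H n" "v \<noteq> 0"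
  shows "m = n"
proof (rule ccontr)
  assume "m \<noteq> n"
  have "(if m = m then v else - v) = 0"
    by (rule homogeneous_sum_eq_0[OF G \<open>subspace V\<close>, of "{m, n}" "\<lambda>k. if k = m then v else - v"])
      (use \<open>m \<noteq> n\<close> assms grading_subspace[OF G] in \<open>auto simp: subspace_neg\<close>)
  then show False using \<open>v \<noteq> 0\<close> by simp
qed

lemma L0_decomposition:
  assumes G: "direct_sum_grading scale V H" and "v \<in> V" and dec: "homogeneous_decomposition H u v"
    and S: "finite S" "{n. u n \<noteq> 0} \<subseteq> S"
  shows "L0 scale H v = (\<Sum>n\<in>S. of_int n *s u n)"
proof -
  have "(THE u. homogeneous_decomposition H u v) = u"
    using dec grading_decomposition_unique[OF G \<open>v \<in> V\<close>] by blast
  then have "L0 scale H v = Sum_any (\<lambda>n. of_int n *s u n)"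
    unfolding L0_def by simp
  also have "\<dots> = (\<Sum>n\<in>S. of_int n *s u n)"
    using S by (intro Sum_any.expand_superset) auto
  finally show ?thesis .
qed

lemma L0_linear_on:
  assumes G: "direct_sum_grading scale V H" and V: "subspace V"
  shows "linear_on scale scale V V (L0 scale H)"
  unfolding linear_on_def
proof (intro conjI ballI allI)
  show "L0 scale H ` V \<subseteq> V"
  proof
    fix y assume "y \<in> L0 scale H ` V"
    then obtain v where v: "v \<in> V" "y = L0 scale H v" by blast
    obtain u where u: "homogeneous_decomposition H u v"
      using grading_decomposition[OF G v(1)] by blast
    then have "\<And>n. u n \<in> V" "finite {n. u n \<noteq> 0}"
      using grading_subset[OF G] unfolding homogeneous_decomposition_def by auto
    then show "y \<in> V"
      using v L0_decomposition[OF G v(1) u, of "{n. u n \<noteq> 0}"] V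
      by (auto intro!: subspace_sum subspace_scale)
  qed
next
  fix x y assume "x \<in> V" "y \<in> V"
  then obtain u u' where u: "homogeneous_decomposition H u x" "homogeneous_decomposition H u' y"
    using grading_decomposition[OF G] by blast
  let ?S = "{n. u n \<noteq> 0} \<union> {n. u' n \<noteq> 0}"
  have S: "finite ?S" "{n. u n \<noteq> 0} \<subseteq> ?S" "{n. u' n \<noteq> 0} \<subseteq> ?S" "{n. u n + u' n \<noteq> 0} \<subseteq> ?S"
    using u unfolding homogeneous_decomposition_def by auto
  have "homogeneous_decomposition H (\<lambda>n. u n + u' n) (x + y)"
    using u grading_subspace[OF G] finite_subset[OF S(4,1)]
    unfolding homogeneous_decomposition_def by (auto simp: Sum_any.distrib subspace_add)
  from L0_decomposition[OF G _ this S(1,4)] \<open>x \<in> V\<close> \<open>y \<in> V\<close> V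
  show "L0 scale H (x + y) = L0 scale H x + L0 scale H y"
    using L0_decomposition[OF G \<open>x \<in> V\<close> u(1) S(1,2)] L0_decomposition[OF G \<open>y \<in> V\<close> u(2) S(1,3)]
    by (simp add: subspace_add scale_right_distrib sum.distrib)
next
  fix c x assume "x \<in> V"
  then obtain u where u: "homogeneous_decomposition H u x"
    using grading_decomposition[OF G] by blast
  let ?S = "{n. u n \<noteq> 0}"
  have S: "finite ?S" "{n. c *s u n \<noteq> 0} \<subseteq> ?S"
    using u unfolding homogeneous_decomposition_def by auto
  have "Sum_any (\<lambda>n. c *s u n) = c *s x"
    using homogeneous_decomposition_sum[OF u] S
    by (simp add: Sum_any.expand_superset[of ?S] scale_sum_right)
  then have "homogeneous_decomposition H (\<lambda>n. c *s u n) (c *s x)"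
    using u grading_subspace[OF G] finite_subset[OF S(2,1)]
    unfolding homogeneous_decomposition_def by (auto simp: subspace_scale)
  from L0_decomposition[OF G _ this S] \<open>x \<in> V\<close> V
  show "L0 scale H (c *s x) = c *s L0 scale H x"
    using L0_decomposition[OF G \<open>x \<in> V\<close> u S(1)]
    by (simp add: subspace_scale scale_sum_right mult.commute)
qed

lemma L0_weight_space:
  assumes "direct_sum_grading scale V H" "v \<in> H n"
  shows "L0 scale H v = of_int n *s v"
  by (rule L0_homogeneous[OF vector_space_axioms assms])

text \<open>
  Distinct weights are distinct eigenvalues: if \<open>v\<close> has the components \<open>u k\<close> and
  \<open>L(0) v = n v\<close>, then the vectors \<open>(k - n) u k\<close> are homogeneous of distinct weights and sum to
  \<open>0\<close>, so only \<open>u n\<close> can be non-zero.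
\<close>

lemma L0_eigenvector_homogeneous:
  assumes G: "direct_sum_grading scale V H" and V: "subspace V" and v: "v \<in> V"
    and eigen: "L0 scale H v = of_int n *s v"
  shows "v \<in> H n"
proof -
  obtain u where u: "homogeneous_decomposition H u v"
    using grading_decomposition[OF G v] by blast
  let ?S = "insert n {k. u k \<noteq> 0}"
  have fin: "finite ?S" and uH: "\<And>k. u k \<in> H k"
    using u unfolding homogeneous_decomposition_def by auto
  have vS: "v = (\<Sum>k\<in>?S. u k)"
    using homogeneous_decomposition_sum[OF u] fin by (simp add: sum.insert_if)
  have "(\<Sum>k\<in>?S. of_int (k - n) *s u k) = L0 scale H v - of_int n *s v"
    using L0_decomposition[OF G v u fin] vS
    by (simp add: scale_left_diff_distrib sum_subtractf scale_sum_right subset_insertI)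
  then have sum0: "(\<Sum>k\<in>?S. of_int (k - n) *s u k) = 0"
    using eigen by simp
  have "u k = 0" if "k \<noteq> n" for k
  proof (cases "k \<in> ?S")
    case True
    have "of_int (k - n) *s u k = 0"
      by (rule homogeneous_sum_eq_0[OF G V fin _ sum0 True])
        (use uH grading_subspace[OF G] in \<open>auto simp: subspace_scale\<close>)
    then show ?thesis using that by simp
  qed auto
  then have "v = u n"
    using vS fin by (simp add: sum.remove[of ?S n])
  then show ?thesis using uH by simp
qed

lemma span_weight_spaces:
  assumes G: "direct_sum_grading scale V H" and V: "subspace V"
  shows "span (\<Union>n. H n) = V"
proof
  show "span (\<Union>n. H n) \<subseteq> V"
    using grading_subset[OF G] V by (intro span_minimal) auto
  show "V \<subseteq> span (\<Union>n. H n)"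
  proof
    fix v assume "v \<in> V"
    then obtain u where u: "homogeneous_decomposition H u v"
      using grading_decomposition[OF G] by blast
    then have "\<And>n. u n \<in> (\<Union>n. H n)"
      unfolding homogeneous_decomposition_def by blast
    then show "v \<in> span (\<Union>n. H n)"
      by (subst homogeneous_decomposition_sum[OF u]) (intro span_sum span_base)
  qed
qed

lemma independent_Union_of_weights:
  assumes G: "direct_sum_grading scale V H" and V: "subspace V"
    and ind: "\<And>n. independent (B n)" and sub: "\<And>n. B n \<subseteq> H n"
  shows "independent (\<Union>n. B n)"
  unfolding independent_explicit_module
proof (intro allI impI)
  fix t u v
  assume t: "finite t" "t \<subseteq> (\<Union>n. B n)" and sum: "(\<Sum>v\<in>t. u v *s v) = 0" and v: "v \<in> t"
  obtain w where w: "\<And>x. x \<in> t \<Longrightarrow> x \<in> B (w x)"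
    using t(2) by (metis (no_types) UN_iff subsetD)
  let ?S = "\<lambda>n. \<Sum>x\<in>{x\<in>t. w x = n}. u x *s x"
  have "(\<Sum>n\<in>w ` t. ?S n) = 0"
    using sum.group[of t "w ` t" w "\<lambda>x. u x *s x"] t(1) sum by simp
  moreover have "?S n \<in> H n" for n
    using w sub[of n] grading_subspace[OF G, of n] by (auto intro!: subspace_sum subspace_scale)
  ultimately have "?S (w v) = 0"
    using homogeneous_sum_eq_0[OF G V, of "w ` t" ?S "w v"] t(1) v by simp
  moreover have "{x\<in>t. w x = w v} \<subseteq> B (w v)"
    using w by fastforce
  ultimately show "u v = 0"
    using independentD[OF ind[of "w v"], of "{x\<in>t. w x = w v}" u v] t(1) v by simp
qed

end

sublocale vertex_algebra \<subseteq> complex_vector_space scale ..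

context grading_restricted_vertex_algebra
begin

lemma state_field_in: "a \<in> underlying A \<Longrightarrow> v \<in> underlying A \<Longrightarrow> state_field A a k v \<in> underlying A"
  by (rule linear_on_in[OF state_field_endo])

text \<open>
  The commutator formula turns \<open>u\<close> and \<open>v\<close> of weights \<open>p\<close> and \<open>q\<close> into an
  eigenvector of \<open>L(0)\<close> with eigenvalue \<open>p + q + k\<close>.
\<close>

lemma state_field_weight:
  assumes u: "u \<in> weight_space A p" and v: "v \<in> weight_space A q"
  shows "state_field A u k v \<in> weight_space A (p + q + k)"
proof (rule L0_eigenvector_homogeneous[OF grading subspace_underlying])
  have V: "u \<in> underlying A" "v \<in> underlying A"
    using assms grading_subset[OF grading] by auto
  then show "state_field A u k v \<in> underlying A"
    by (rule state_field_in)
  show "L0 scale (weight_space A) (state_field A u k v) = scale (of_int (p + q + k)) (state_field A u k v)"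
    using L0_commutator[OF V, of k] L0_weight_space[OF grading u] L0_weight_space[OF grading v]
      linear_on_scale[OF state_field_endo[OF V(1)] V(2)]
      linear_on_scale[OF state_field_linear[OF V(2)] V(1)]
    by (simp add: scale_left_distrib algebra_simps)
qed

lemma weight_space_basis:
  obtains B where "finite B" "independent B" "span B = weight_space A n"
proof -
  obtain D where D: "finite D" "span D = weight_space A n"
    using finite_dim by blast
  obtain B where B: "B \<subseteq> weight_space A n" "independent B" "weight_space A n \<subseteq> span B"
    using maximal_independent_subset by blast
  have "finite B" using independent_span_bound[OF D(1) B(2)] B(1) D(2) by simp
  moreover have "span B = weight_space A n"
    using B span_minimal[OF B(1) grading_subspace[OF grading]] by blast
  ultimately show thesis using B(2) that by blast
qed

end

text \<open>
  The converse of \<open>state_field_weight\<close>. Both sides are bilinear in \<open>(v, w)\<close>, so the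
  homogeneous case, where each term is a multiple of the product, suffices.
\<close>

lemma (in vertex_algebra) L0_commutator_of_weights:
  assumes G: "direct_sum_grading scale (underlying A) H"
    and weight: "\<And>p q k u v. u \<in> H p \<Longrightarrow> v \<in> H q \<Longrightarrow> state_field A u k v \<in> H (p + q + k)"
    and "v \<in> underlying A" "w \<in> underlying A"
  shows "L0 scale H (state_field A v k w) - state_field A v k (L0 scale H w)
    = scale (of_int k) (state_field A v k w) + state_field A (L0 scale H v) k w"
proof -
  note V = subspace_underlying
  note L = L0_linear_on[OF G V]
  have in_V: "state_field A a k b \<in> underlying A" if "a \<in> underlying A" "b \<in> underlying A" for a b
    using linear_on_in[OF state_field_endo] that .
  note lin_simps = linear_on_add[OF L] linear_on_scale[OF L]
    linear_on_add[OF state_field_endo] linear_on_scale[OF state_field_endo]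
    linear_on_add[OF state_field_linear] linear_on_scale[OF state_field_linear]
    linear_on_in[OF L] in_V subspace_scale[OF V]
  have field_zero: "state_field A a k 0 = 0" "state_field A 0 k a = 0" if "a \<in> underlying A" for a
    using linear_on_zero[OF state_field_endo] linear_on_zero[OF state_field_linear] that
    by (auto simp: subspace_0 V)
  note L_zero = linear_on_zero[OF L subspace_0[OF V]]
  have hom: "L0 scale H (state_field A a k b) - state_field A a k (L0 scale H b)
    = scale (of_int k) (state_field A a k b) + state_field A (L0 scale H a) k b"
    if a: "a \<in> H p" and b: "b \<in> H q" for a b p q
  proof -
    have "a \<in> underlying A" "b \<in> underlying A"
      using a b grading_subset[OF G] by auto
    then show ?thesis
      by (simp add: L0_weight_space[OF G a] L0_weight_space[OF G b] L0_weight_space[OF G weight[OF a b]]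
        lin_simps scale_left_distrib)
  qed
  have span: "span (\<Union>n. H n) = underlying A"
    by (rule span_weight_spaces[OF G V])
  have right: "L0 scale H (state_field A a k b) - state_field A a k (L0 scale H b)
    = scale (of_int k) (state_field A a k b) + state_field A (L0 scale H a) k b"
    if a: "a \<in> H p" and b: "b \<in> span (\<Union>n. H n)" for a b p
    using b
  proof (induction rule: subspace_span_induct)
    case zero
    have "a \<in> underlying A" using a grading_subset[OF G] by auto
    then show ?case by (simp add: field_zero L_zero lin_simps)
  next
    case (scale_add c x y)
    have "a \<in> underlying A" using a grading_subset[OF G] by auto
    moreover have "x \<in> underlying A" "y \<in> underlying A" using scale_add span by auto
    moreover note scale_add(3,4)[unfolded diff_eq_eq]
    ultimately show ?case
      by (simp add: lin_simps algebra_simps)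
  qed (use hom a in auto)
  have "v \<in> span (\<Union>n. H n)" using span assms by simp
  then show ?thesis
  proof (induction rule: subspace_span_induct)
    case zero
    then show ?case using \<open>w \<in> underlying A\<close> by (simp add: field_zero L_zero lin_simps)
  next
    case (scale_add c x y)
    have "x \<in> underlying A" "y \<in> underlying A" using scale_add span by auto
    moreover note scale_add(3,4)[unfolded diff_eq_eq]
    ultimately show ?case using \<open>w \<in> underlying A\<close>
      by (simp add: lin_simps algebra_simps)
  qed (use right assms span in auto)
qed

section \<open>Increasing sequences of vertex algebras in one space\<close>

text \<open>
  The situation that remains once every algebra of a direct system is identified with its
  image in the limit. The products \<open>Y M\<close> and \<open>Y N\<close> are unrelated even on the smaller space.
  Of the commutator formula only its consequence for weights is recorded.
\<close>

locale stabilizing_vertex_algebras = complex_vector_space scale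
  for scale :: "complex \<Rightarrow> 'w::ab_group_add \<Rightarrow> 'w" (infixr "*s" 75) +
  fixes T :: "nat \<Rightarrow> 'w graded_vertex_structure"
  assumes algebra: "vertex_algebra scale (T N)"
    and graded: "direct_sum_grading scale (underlying (T N)) (weight_space (T N))"
    and weight: "u \<in> weight_space (T N) p \<Longrightarrow> v \<in> weight_space (T N) q \<Longrightarrow>
        state_field (T N) u k v \<in> weight_space (T N) (p + q + k)"
    and mono: "M \<le> N \<Longrightarrow> weight_space (T M) n \<subseteq> weight_space (T N) n"
    and same_vacuum: "vacuum (T N) = vacuum (T 0)"
    and stable: "\<exists>K. \<forall>N\<ge>K. weight_space (T N) n = weight_space (T K) n"
    and bounded: "\<exists>nbar. \<forall>\<^sub>F N in sequentially. \<forall>n<nbar. weight_space (T N) n = {0}"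
begin

abbreviation U :: "nat \<Rightarrow> 'w set" where
  "U N \<equiv> underlying (T N)"

abbreviation Y :: "nat \<Rightarrow> 'w \<Rightarrow> int \<Rightarrow> 'w \<Rightarrow> 'w" where
  "Y N \<equiv> state_field (T N)"

definition total :: "'w set" where
  "total = (\<Union>N. U N)"

definition H :: "int \<Rightarrow> 'w set" where
  "H n = (\<Union>N. weight_space (T N) n)"

lemma U_subspace: "subspace (U N)"
  by (rule vertex_algebra.subspace_underlying[OF algebra])

lemma Y_linear_right: "u \<in> U N \<Longrightarrow> linear_on scale scale (U N) (U N) (Y N u k)"
  and Y_linear_left: "v \<in> U N \<Longrightarrow> linear_on scale scale (U N) (U N) (\<lambda>u. Y N u k v)"
  using vertex_algebra.state_field_endo[OF algebra] vertex_algebra.state_field_linear[OF algebra]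
  by blast+

lemma U_mono: "M \<le> N \<Longrightarrow> U M \<subseteq> U N"
  using span_weight_spaces[OF graded U_subspace, of M] span_weight_spaces[OF graded U_subspace, of N]
    span_mono[of "\<Union>n. weight_space (T M) n" "\<Union>n. weight_space (T N) n"] mono[of M N]
  by blast

text \<open>
  Statements about fixed vectors hold in the algebra \<open>T N\<close> only from some \<open>N\<close> on; the filter
  \<open>sequentially\<close> absorbs the choice of these thresholds.
\<close>

lemma eventually_in_U: "u \<in> total \<Longrightarrow> \<forall>\<^sub>F N in sequentially. u \<in> U N"
  unfolding total_def eventually_sequentially using U_mono by blast

lemma eventually_weight_space: "\<forall>\<^sub>F N in sequentially. weight_space (T N) n = H n"
proof -
  obtain K where K: "\<And>N. N \<ge> K \<Longrightarrow> weight_space (T N) n = weight_space (T K) n"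
    using stable by blast
  have "weight_space (T N) n \<subseteq> weight_space (T K) n" for N
    using mono[of N "max N K" n] K[of "max N K"] by simp
  then have "H n = weight_space (T K) n"
    unfolding H_def by blast
  then show ?thesis
    unfolding eventually_sequentially using K by blast
qed

lemma weight_space_subset_H: "weight_space (T N) n \<subseteq> H n"
  unfolding H_def by blast

lemma total_subspace: "subspace total"
proof (rule subspaceI)
  show "0 \<in> total"
    unfolding total_def using U_subspace by (auto simp: subspace_0)
next
  fix x y assume "x \<in> total" "y \<in> total"
  then have "\<forall>\<^sub>F N in sequentially. x \<in> U N \<and> y \<in> U N"
    by (simp add: eventually_conj_iff eventually_in_U)
  then obtain N where "x \<in> U N" "y \<in> U N"
    by (auto dest: eventually_happens)
  then show "x + y \<in> total"
    unfolding total_def using U_subspace subspace_add by blast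
next
  fix c x assume "x \<in> total"
  then show "c *s x \<in> total"
    unfolding total_def using U_subspace subspace_scale by blast
qed

text \<open>
  A decomposition has finite support, so any two decompositions of a vector are already
  decompositions inside a single \<open>T K\<close>, where they are unique.
\<close>

lemma total_grading: "direct_sum_grading scale total H"
  unfolding direct_sum_grading_def
proof (intro conjI allI ballI)
  fix n
  obtain N where N: "weight_space (T N) n = H n"
    using eventually_happens[OF eventually_weight_space] by auto
  show "subspace (H n)"
    using grading_subspace[OF graded, of N n] N by simp
  show "H n \<subseteq> total"
    using grading_subset[OF graded, of N n] N unfolding total_def by blast
next
  fix v assume v: "v \<in> total"
  then obtain N where N: "v \<in> U N"
    unfolding total_def by blast
  obtain u where u: "homogeneous_decomposition (weight_space (T N)) u v"
    using grading_decomposition[OF graded N] by blast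
  have "homogeneous_decomposition H u v"
    using u weight_space_subset_H unfolding homogeneous_decomposition_def by blast
  moreover have "u = u'" if "homogeneous_decomposition H u v" "homogeneous_decomposition H u' v" for u u'
  proof -
    let ?S = "{n. u n \<noteq> 0} \<union> {n. u' n \<noteq> 0}"
    have fin: "finite ?S"
      using that unfolding homogeneous_decomposition_def by simp
    have "\<forall>\<^sub>F K in sequentially. v \<in> U K \<and> (\<forall>n\<in>?S. weight_space (T K) n = H n)"
      using eventually_in_U[OF v] eventually_weight_space fin
      by (simp add: eventually_conj_iff eventually_ball_finite_distrib del: Un_iff)
    then obtain K where K: "v \<in> U K" "\<And>n. n \<in> ?S \<Longrightarrow> weight_space (T K) n = H n"
      by (auto dest!: eventually_happens)
    have "0 \<in> weight_space (T K) n" for n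
      using grading_subspace[OF graded] subspace_0 by blast
    then have "homogeneous_decomposition (weight_space (T K)) u v"
        "homogeneous_decomposition (weight_space (T K)) u' v"
      using that K(2) unfolding homogeneous_decomposition_def by (metis (mono_tags) UnCI mem_Collect_eq)+
    then show "u = u'"
      using grading_decomposition_unique[OF graded K(1)] by blast
  qed
  ultimately show "\<exists>!u. homogeneous_decomposition H u v" by blast
qed

lemma H_bounded_below: "\<exists>n0. \<forall>n<n0. H n = {0}"
proof -
  obtain nbar where "\<forall>\<^sub>F N in sequentially. \<forall>n<nbar. weight_space (T N) n = {0}"
    using bounded by blast
  then have "\<forall>\<^sub>F N in sequentially. (\<forall>n<nbar. weight_space (T N) n = {0}) \<and> weight_space (T N) n = H n" for n
    using eventually_weight_space by (simp add: eventually_conj_iff)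
  then have "\<forall>n<nbar. H n = {0}"
    by (metis (mono_tags, lifting) eventually_happens trivial_limit_sequentially)
  then show ?thesis by blast
qed

text \<open>
  For homogeneous \<open>u\<close> and \<open>v\<close> of weights \<open>p\<close> and \<open>q\<close> the weight \<open>p + q - n - 1\<close> of the
  \<open>n\<close>-th product drops below the common lower bound of the weights as soon as
  \<open>n \<ge> p + q - nbar\<close>, whatever \<open>N\<close> is. The general case follows by bilinearity.
\<close>

lemma uniform_truncation:
  assumes "u \<in> total" "v \<in> total"
  shows "\<exists>n0. \<forall>\<^sub>F N in sequentially. \<forall>n\<ge>n0. mode (T N) u n v = 0"
proof -
  let ?P = "\<lambda>u v. \<exists>n0. \<forall>\<^sub>F N in sequentially. \<forall>n\<ge>n0. mode (T N) u n v = 0"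
  have total: "total = span (\<Union>n. H n)"
    using span_weight_spaces[OF total_grading total_subspace] by simp
  have hom: "?P u v" if u: "u \<in> H p" and v: "v \<in> H q" for u v p q
  proof -
    obtain nbar where nbar: "\<forall>\<^sub>F N in sequentially. \<forall>n<nbar. weight_space (T N) n = {0}"
      using bounded by blast
    have "\<forall>\<^sub>F N in sequentially. \<forall>n\<ge>p + q - nbar. mode (T N) u n v = 0"
      using nbar eventually_weight_space[of p] eventually_weight_space[of q]
    proof eventually_elim
      case (elim N)
      show ?case
      proof (intro allI impI)
        fix n assume "n \<ge> p + q - nbar"
        then have "p + q + (- n - 1) < nbar" by simp
        moreover have "mode (T N) u n v \<in> weight_space (T N) (p + q + (- n - 1))"
          unfolding mode_def using weight[of u N p v q "- n - 1"] u v elim by simp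
        ultimately show "mode (T N) u n v = 0" using elim by blast
      qed
    qed
    then show ?thesis by blast
  qed
  have right: "?P u v" if u: "u \<in> H p" and v: "v \<in> span (\<Union>n. H n)" for u v p
    using v
  proof (induction rule: subspace_span_induct)
    case (base b)
    then show ?case using hom u by blast
  next
    case zero
    have "\<forall>\<^sub>F N in sequentially. u \<in> U N"
      using u grading_subset[OF total_grading] eventually_in_U by blast
    then have "\<forall>\<^sub>F N in sequentially. \<forall>n\<ge>0. mode (T N) u n 0 = 0"
      by eventually_elim (simp add: mode_def linear_on_zero[OF Y_linear_right] subspace_0 U_subspace)
    then show ?case by blast
  next
    case (scale_add c x y)
    from scale_add(3,4) obtain m n where
      m: "\<forall>\<^sub>F N in sequentially. \<forall>k\<ge>m. mode (T N) u k x = 0" and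
      n: "\<forall>\<^sub>F N in sequentially. \<forall>k\<ge>n. mode (T N) u k y = 0" by blast
    have U: "\<forall>\<^sub>F N in sequentially. u \<in> U N" "\<forall>\<^sub>F N in sequentially. x \<in> U N"
        "\<forall>\<^sub>F N in sequentially. y \<in> U N"
      using u scale_add(1,2) grading_subset[OF total_grading] eventually_in_U total by blast+
    have "\<forall>\<^sub>F N in sequentially. \<forall>k\<ge>max m n. mode (T N) u k (c *s x + y) = 0"
      using m n U by eventually_elim (simp add: mode_def linear_on_add[OF Y_linear_right]
        linear_on_scale[OF Y_linear_right] subspace_scale U_subspace)
    then show ?case by blast
  qed
  have "u \<in> span (\<Union>n. H n)" using assms total by simp
  then show ?thesis
  proof (induction rule: subspace_span_induct)
    case (base b)
    then show ?case using right assms total by blast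
  next
    case zero
    have "\<forall>\<^sub>F N in sequentially. \<forall>n\<ge>0. mode (T N) 0 n v = 0"
      using eventually_in_U[OF assms(2)]
      by eventually_elim (simp add: mode_def linear_on_zero[OF Y_linear_left] subspace_0 U_subspace)
    then show ?case by blast
  next
    case (scale_add c x y)
    from scale_add(3,4) obtain m n where
      m: "\<forall>\<^sub>F N in sequentially. \<forall>k\<ge>m. mode (T N) x k v = 0" and
      n: "\<forall>\<^sub>F N in sequentially. \<forall>k\<ge>n. mode (T N) y k v = 0" by blast
    have U: "\<forall>\<^sub>F N in sequentially. v \<in> U N" "\<forall>\<^sub>F N in sequentially. x \<in> U N"
        "\<forall>\<^sub>F N in sequentially. y \<in> U N"
      using assms scale_add(1,2) eventually_in_U total by blast+
    have "\<forall>\<^sub>F N in sequentially. \<forall>k\<ge>max m n. mode (T N) (c *s x + y) k v = 0"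
      using m n U by eventually_elim (simp add: mode_def linear_on_add[OF Y_linear_left]
        linear_on_scale[OF Y_linear_left] subspace_scale U_subspace)
    then show ?case by blast
  qed
qed

end

section \<open>Limits of the products\<close>

text \<open>
  \<open>F\<close> is the candidate for the limit of the products and \<open>C\<close> the family of limit structure
  constants. The coefficient of \<open>z\<^sup>k\<close> in the product of vectors of weights \<open>p\<close> and \<open>q\<close> lies in
  weight \<open>p + q + k\<close>, so only coordinates with respect to \<open>\<Phi> (p + q + k)\<close> occur.
\<close>

locale convergent_vertex_algebras = stabilizing_vertex_algebras scale T
  for scale :: "complex \<Rightarrow> 'w::ab_group_add \<Rightarrow> 'w" (infixr "*s" 75)
    and T :: "nat \<Rightarrow> 'w graded_vertex_structure" +
  fixes \<Phi> :: "int \<Rightarrow> 'w set"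
    and F :: "'w \<Rightarrow> int \<Rightarrow> 'w \<Rightarrow> 'w"
    and C :: "'w \<Rightarrow> 'w \<Rightarrow> 'w \<Rightarrow> complex"
  assumes basis_independent: "independent (\<Phi> n)"
    and basis_finite: "finite (\<Phi> n)"
    and basis_span: "span (\<Phi> n) = H n"
    and limit_coordinates: "a \<in> \<Phi> (p + q + k) \<Longrightarrow> b \<in> \<Phi> p \<Longrightarrow> c \<in> \<Phi> q \<Longrightarrow>
      (\<lambda>N. representation (\<Phi> (p + q + k)) (Y N b k c) a) \<longlonglongrightarrow> C a b c"
    and F_basis: "b \<in> \<Phi> p \<Longrightarrow> c \<in> \<Phi> q \<Longrightarrow> F b k c = (\<Sum>a\<in>\<Phi> (p + q + k). C a b c *s a)"
    and F_right: "u \<in> total \<Longrightarrow> linear_on scale scale total UNIV (F u k)"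
    and F_left: "v \<in> total \<Longrightarrow> linear_on scale scale total UNIV (\<lambda>u. F u k v)"
begin

definition E :: "'w set" where
  "E = (\<Union>n. \<Phi> n)"

lemma basis_subset_E: "\<Phi> n \<subseteq> E"
  unfolding E_def by blast

abbreviation coord :: "'w \<Rightarrow> 'w \<Rightarrow> complex" where
  "coord \<equiv> representation E"

lemma basis_subset: "\<Phi> n \<subseteq> H n"
  using basis_span span_superset by blast

lemma E_independent: "independent E"
  unfolding E_def by (rule independent_Union_of_weights[OF total_grading total_subspace basis_independent basis_subset])

lemma E_span: "span E = total"
proof
  show "span E \<subseteq> total"
    using basis_subset grading_subset[OF total_grading] unfolding E_def
    by (intro span_minimal total_subspace) blast
  have "H n \<subseteq> span E" for n
    using basis_span[of n] span_mono[OF basis_subset_E, of n] by blast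
  then have "span (\<Union>n. H n) \<subseteq> span E"
    by (intro span_minimal) auto
  then show "total \<subseteq> span E"
    using span_weight_spaces[OF total_grading total_subspace] by simp
qed

lemma E_subset: "E \<subseteq> total"
  using E_span span_superset by blast

text \<open>
  Coordinatewise convergence inside one finite-dimensional subspace. Convergence of all
  coordinates would not suffice for the continuity of products: a sequence of pairwise distinct
  basis vectors tends to \<open>0\<close> in every coordinate, while its products with a second such
  sequence may all be equal to one non-zero vector.
\<close>

definition converges :: "(nat \<Rightarrow> 'w) \<Rightarrow> 'w \<Rightarrow> bool" where
  "converges X x \<longleftrightarrow>
     (\<exists>B\<subseteq>E. finite B \<and> x \<in> span B \<and> (\<forall>\<^sub>F N in sequentially. X N \<in> span B)) \<and>
     (\<forall>a. (\<lambda>N. coord (X N) a) \<longlonglongrightarrow> coord x a)"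

lemma converges_coord: "converges X x \<Longrightarrow> (\<lambda>N. coord (X N) a) \<longlonglongrightarrow> coord x a"
  unfolding converges_def by blast

lemma convergesE:
  assumes "converges X x"
  obtains B where "B \<subseteq> E" "finite B" "x \<in> span B" "\<forall>\<^sub>F N in sequentially. X N \<in> span B"
  using assms unfolding converges_def by blast

lemma converges_total: "converges X x \<Longrightarrow> x \<in> total"
  by (metis E_span convergesE span_mono subsetD)

lemma converges_const:
  assumes "x \<in> total"
  shows "converges (\<lambda>N. x) x"
proof -
  let ?B = "{b. coord x b \<noteq> 0}"
  have "?B \<subseteq> E"
    by (rule subsetI) (rule representation_ne_zero[of E x], simp)
  moreover have "x \<in> span ?B"
  proof (rule span_support[OF E_independent])
    show "x \<in> span E" using assms E_span by simp
  qed simp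
  moreover have "finite ?B" by (rule finite_representation)
  ultimately show ?thesis
    unfolding converges_def by (intro conjI exI[of _ ?B] allI) simp_all
qed

lemma converges_cong:
  assumes "\<forall>\<^sub>F N in sequentially. X N = X' N" "converges X x"
  shows "converges X' x"
proof -
  obtain B where B: "B \<subseteq> E" "finite B" "x \<in> span B" "\<forall>\<^sub>F N in sequentially. X N \<in> span B"
    using assms(2) by (rule convergesE)
  have "\<forall>\<^sub>F N in sequentially. X' N \<in> span B"
    using assms(1) B(4) by eventually_elim simp
  moreover have "(\<lambda>N. coord (X' N) a) \<longlonglongrightarrow> coord x a" for a
    using assms(1) by (intro Lim_transform_eventually[OF converges_coord[OF assms(2)]])
      (auto elim: eventually_mono)
  ultimately show ?thesis unfolding converges_def using B by blast
qed

lemma converges_scale_add: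
  assumes "converges X x" "converges Z z" "c \<longlonglongrightarrow> c0"
  shows "converges (\<lambda>N. c N *s X N + Z N) (c0 *s x + z)"
proof -
  obtain B where B: "B \<subseteq> E" "finite B" "x \<in> span B" "\<forall>\<^sub>F N in sequentially. X N \<in> span B"
    using assms(1) by (rule convergesE)
  obtain B' where B': "B' \<subseteq> E" "finite B'" "z \<in> span B'" "\<forall>\<^sub>F N in sequentially. Z N \<in> span B'"
    using assms(2) by (rule convergesE)
  have le: "span B \<subseteq> span (B \<union> B')" "span B' \<subseteq> span (B \<union> B')"
      "span (B \<union> B') \<subseteq> span E"
    using B(1) B'(1) by (auto intro!: span_mono)
  have ev: "\<forall>\<^sub>F N in sequentially. X N \<in> span (B \<union> B') \<and> Z N \<in> span (B \<union> B')"
    using B(4) B'(4) by eventually_elim (use le in blast)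
  have coord_comb: "coord (d *s v + w) a = d * coord v a + coord w a"
    if "v \<in> span (B \<union> B')" "w \<in> span (B \<union> B')" for d v w a
    using that le E_independent by (simp add: representation_add representation_scale span_scale subset_iff)
  have x: "x \<in> span (B \<union> B')" "z \<in> span (B \<union> B')"
    using B(3) B'(3) le by blast+
  have "(\<lambda>N. coord (c N *s X N + Z N) a) \<longlonglongrightarrow> coord (c0 *s x + z) a" for a
  proof -
    have "(\<lambda>N. c N * coord (X N) a + coord (Z N) a) \<longlonglongrightarrow> c0 * coord x a + coord z a"
      using assms by (intro tendsto_intros converges_coord)
    moreover have "\<forall>\<^sub>F N in sequentially.
        c N * coord (X N) a + coord (Z N) a = coord (c N *s X N + Z N) a"
      using ev by eventually_elim (simp add: coord_comb)
    ultimately show ?thesis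
      using coord_comb[OF x] Lim_transform_eventually by fastforce
  qed
  moreover have "\<forall>\<^sub>F N in sequentially. c N *s X N + Z N \<in> span (B \<union> B')"
    using ev by eventually_elim (simp add: span_add span_scale)
  moreover have "c0 *s x + z \<in> span (B \<union> B')"
    using x by (simp add: span_add span_scale)
  moreover have "B \<union> B' \<subseteq> E" "finite (B \<union> B')"
    using B B' by auto
  ultimately show ?thesis unfolding converges_def by blast
qed

lemma converges_zero: "converges (\<lambda>N. 0) 0"
  by (rule converges_const) (rule subspace_0[OF total_subspace])

lemma converges_scale:
  "converges X x \<Longrightarrow> c \<longlonglongrightarrow> c0 \<Longrightarrow> converges (\<lambda>N. c N *s X N) (c0 *s x)"
  using converges_scale_add[OF _ converges_zero] by simp

lemma converges_add:
  "converges X x \<Longrightarrow> converges Z z \<Longrightarrow> converges (\<lambda>N. X N + Z N) (x + z)"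
  using converges_scale_add[of X x Z z "\<lambda>_. 1" 1] by simp

lemma converges_diff:
  "converges X x \<Longrightarrow> converges Z z \<Longrightarrow> converges (\<lambda>N. X N - Z N) (x - z)"
  using converges_scale_add[of Z z X x "\<lambda>_. -1" "-1"] by simp

lemma converges_sum:
  "(\<And>i. i \<in> I \<Longrightarrow> converges (X i) (x i)) \<Longrightarrow> converges (\<lambda>N. \<Sum>i\<in>I. X i N) (\<Sum>i\<in>I. x i)"
  by (induction I rule: infinite_finite_induct) (simp_all add: converges_zero converges_add)

lemma converges_unique:
  assumes "converges X x" "converges X x'"
  shows "x = x'"
proof -
  have "coord x = coord x'"
    using LIMSEQ_unique[OF converges_coord[OF assms(1)] converges_coord[OF assms(2)]] by blast
  moreover have "x \<in> span E" "x' \<in> span E"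
    using assms converges_total E_span by auto
  ultimately show ?thesis
    using sum_nonzero_representation_eq[OF E_independent] by metis
qed

text \<open>
  Finitely many or not, the basis vectors of \<open>B\<close> span a closed subspace, because it is cut out
  by the vanishing of the other coordinates.
\<close>

lemma converges_in_span:
  assumes "converges X x" "\<forall>\<^sub>F N in sequentially. X N \<in> span B" "B \<subseteq> E"
  shows "x \<in> span B"
proof (rule span_support[OF E_independent])
  show "x \<in> span E"
    using converges_total[OF assms(1)] E_span by simp
  fix b assume nz: "coord x b \<noteq> 0"
  show "b \<in> B"
  proof (rule ccontr)
    assume "b \<notin> B"
    have "\<forall>\<^sub>F N in sequentially. coord (X N) b = 0"
      using assms(2)
    proof eventually_elim
      case (elim N)
      then show ?case
        using representation_extend[OF E_independent elim assms(3)] representation_ne_zero[of B "X N" b]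
          \<open>b \<notin> B\<close> by auto
    qed
    then have "(\<lambda>N. coord (X N) b) \<longlonglongrightarrow> 0"
      by (rule tendsto_eventually)
    with converges_coord[OF assms(1)] have "coord x b = 0"
      by (rule LIMSEQ_unique)
    with nz show False by simp
  qed
qed

lemma eventually_subset_U:
  assumes "finite B" "B \<subseteq> total"
  shows "\<forall>\<^sub>F N in sequentially. B \<subseteq> U N"
  unfolding subset_iff using assms eventually_in_U by (simp add: eventually_ball_finite subset_iff flip: Ball_def)

text \<open>
  The hypothesis on the structure constants in terms of convergence: eventually the product lies
  in the span of the finite set \<open>\<Phi> (p + q + k)\<close>, where its coordinates converge.
\<close>

lemma converges_basis_product:
  assumes b: "b \<in> \<Phi> p" and c: "c \<in> \<Phi> q"
  shows "converges (\<lambda>N. Y N b k c) (F b k c)"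
proof -
  let ?B = "\<Phi> (p + q + k)"
  have B: "?B \<subseteq> E" "finite ?B" using basis_subset_E basis_finite by auto
  have ev: "\<forall>\<^sub>F N in sequentially. Y N b k c \<in> span ?B"
    using eventually_weight_space[of p] eventually_weight_space[of q]
      eventually_weight_space[of "p + q + k"]
  proof eventually_elim
    case (elim N)
    then have "b \<in> weight_space (T N) p" "c \<in> weight_space (T N) q"
      using b c basis_subset by blast+
    then have "Y N b k c \<in> weight_space (T N) (p + q + k)" by (rule weight)
    then show ?case using elim basis_span by simp
  qed
  have Fspan: "F b k c \<in> span ?B"
    unfolding F_basis[OF b c] by (intro span_sum span_scale span_base)
  have "(\<lambda>N. coord (Y N b k c) a) \<longlonglongrightarrow> coord (F b k c) a" for a
  proof -
    have ext: "coord v a = representation ?B v a" if "v \<in> span ?B" for v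
      using representation_extend[OF E_independent that B(1)] by simp
    have "(\<lambda>N. representation ?B (Y N b k c) a) \<longlonglongrightarrow> representation ?B (F b k c) a"
    proof (cases "a \<in> ?B")
      case True
      then have "representation ?B (F b k c) a = C a b c"
        unfolding F_basis[OF b c] by (intro representation_sum_scale basis_independent B)
      then show ?thesis using limit_coordinates[OF True b c] by simp
    next
      case False
      then have "representation ?B v a = 0" for v using representation_ne_zero by blast
      then show ?thesis by simp
    qed
    moreover have "\<forall>\<^sub>F N in sequentially. representation ?B (Y N b k c) a = coord (Y N b k c) a"
      using ev by eventually_elim (simp add: ext)
    ultimately show ?thesis
      using ext[OF Fspan] Lim_transform_eventually by fastforce
  qed
  then show ?thesis
    unfolding converges_def using B ev Fspan by blast
qed

text \<open>
  Joint continuity of the products. Both factors eventually lie in fixed finite-dimensional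
  subspaces, so the product is a finite sum, with a range independent of \<open>N\<close>, of products of
  basis vectors with coefficients that are products of two coordinates; each summand converges.
\<close>

lemma converges_product:
  assumes X: "converges X x" and Z: "converges Z z"
  shows "converges (\<lambda>N. Y N (X N) k (Z N)) (F x k z)"
proof -
  obtain B where B: "B \<subseteq> E" "finite B" "x \<in> span B" "\<forall>\<^sub>F N in sequentially. X N \<in> span B"
    using X by (rule convergesE)
  obtain B' where B': "B' \<subseteq> E" "finite B'" "z \<in> span B'" "\<forall>\<^sub>F N in sequentially. Z N \<in> span B'"
    using Z by (rule convergesE)
  have sub: "B \<subseteq> total" "B' \<subseteq> total" using B B' E_subset by blast+
  have F: "F x k z = (\<Sum>b\<in>B. \<Sum>c\<in>B'. (coord x b * coord z c) *s F b k c)"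
    by (rule bilinear_expansion[OF total_subspace E_independent F_right F_left B(2,1) sub(1)
      B'(2,1) sub(2) B(3) B'(3)])
  have "\<forall>\<^sub>F N in sequentially.
      (\<Sum>b\<in>B. \<Sum>c\<in>B'. (coord (X N) b * coord (Z N) c) *s Y N b k c) = Y N (X N) k (Z N)"
    using B(4) B'(4) eventually_subset_U[OF B(2) sub(1)] eventually_subset_U[OF B'(2) sub(2)]
  proof eventually_elim
    case (elim N)
    show ?case
      by (rule bilinear_expansion[OF U_subspace E_independent Y_linear_right Y_linear_left B(2,1) elim(3)
        B'(2,1) elim(4,1,2), symmetric])
  qed
  moreover have "converges (\<lambda>N. \<Sum>b\<in>B. \<Sum>c\<in>B'. (coord (X N) b * coord (Z N) c) *s Y N b k c)
      (\<Sum>b\<in>B. \<Sum>c\<in>B'. (coord x b * coord z c) *s F b k c)"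
  proof (intro converges_sum converges_scale)
    fix b c assume bc: "b \<in> B" "c \<in> B'"
    show "(\<lambda>N. coord (X N) b * coord (Z N) c) \<longlonglongrightarrow> coord x b * coord z c"
      by (intro tendsto_mult converges_coord X Z)
    show "converges (\<lambda>N. Y N b k c) (F b k c)"
      using bc B(1) B'(1) converges_basis_product unfolding E_def by blast
  qed
  ultimately show ?thesis
    unfolding F by (rule converges_cong)
qed

lemma converges_product_const:
  "u \<in> total \<Longrightarrow> v \<in> total \<Longrightarrow> converges (\<lambda>N. Y N u k v) (F u k v)"
  by (intro converges_product converges_const)

lemma F_in_total: "u \<in> total \<Longrightarrow> v \<in> total \<Longrightarrow> F u k v \<in> total"
  using converges_product_const converges_total by blast

text \<open>
  A product that has the same value in all late algebras keeps it in the limit. This is how the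
  axioms on the vacuum and the truncation axiom are inherited.
\<close>

lemma F_eqI:
  assumes "u \<in> total" "v \<in> total" "w \<in> total" "\<forall>\<^sub>F N in sequentially. Y N u k v = w"
  shows "F u k v = w"
  using assms converges_unique[OF converges_product_const[OF assms(1,2)]]
    converges_cong[OF _ converges_const[OF assms(3)], of "\<lambda>N. Y N u k v"]
  by (simp add: eq_commute)

text \<open>
  The products of \<open>u\<close> and \<open>v\<close> eventually lie in the span of \<open>\<Phi> (p + q + k)\<close>, which is closed
  under limits.
\<close>

lemma F_weight:
  assumes u: "u \<in> H p" and v: "v \<in> H q"
  shows "F u k v \<in> H (p + q + k)"
proof -
  have "\<forall>\<^sub>F N in sequentially. Y N u k v \<in> span (\<Phi> (p + q + k))"
    using eventually_weight_space[of p] eventually_weight_space[of q]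
      eventually_weight_space[of "p + q + k"]
    by eventually_elim (metis weight u v basis_span)
  then have "F u k v \<in> span (\<Phi> (p + q + k))"
    using u v grading_subset[OF total_grading]
    by (intro converges_in_span[OF converges_product_const _ basis_subset_E]) auto
  then show ?thesis using basis_span by simp
qed

definition limit :: "'w graded_vertex_structure" where
  "limit = \<lparr>underlying = total, vacuum = vacuum (T 0), state_field = F, weight_space = H\<rparr>"

lemma limit_simps [simp]:
  "underlying limit = total" "vacuum limit = vacuum (T 0)" "state_field limit = F"
  "weight_space limit = H" "mode limit u n = F u (- n - 1)"
  unfolding limit_def mode_def by simp_all

lemma vacuum_in_U: "vacuum (T 0) \<in> U N"
  using vertex_algebra.vacuum_in[OF algebra, of N] same_vacuum[of N] by simp

lemma vacuum_in_total: "vacuum (T 0) \<in> total"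
  using vacuum_in_U unfolding total_def by blast

lemma F_truncation:
  assumes "u \<in> total" "v \<in> total"
  shows "\<exists>n0. (\<forall>n\<ge>n0. F u (- n - 1) v = 0) \<and> (\<forall>\<^sub>F N in sequentially. \<forall>n\<ge>n0. mode (T N) u n v = 0)"
proof -
  obtain n0 where n0: "\<forall>\<^sub>F N in sequentially. \<forall>n\<ge>n0. mode (T N) u n v = 0"
    using uniform_truncation[OF assms] by blast
  have "F u (- n - 1) v = 0" if "n \<ge> n0" for n
    using n0 that assms by (intro F_eqI subspace_0[OF total_subspace])
      (auto simp: mode_def elim!: eventually_mono)
  with n0 show ?thesis by blast
qed

text \<open>
  Joint continuity gives convergence of every single term of the three sums, and uniform
  truncation gives one bound \<open>J\<close> for their ranges, valid for all large \<open>N\<close> and for the limit.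
\<close>

lemma limit_Borcherds:
  assumes a: "a \<in> total" and b: "b \<in> total" and c: "c \<in> total"
  defines "M \<equiv> mode limit"
  shows "Sum_any (\<lambda>j::nat. (of_int m gchoose j) *s M (M a (n + int j) b) (m + k - int j) c)
    = Sum_any (\<lambda>j::nat. ((-1) ^ j * (of_int n gchoose j)) *s M a (m + n - int j) (M b (k + int j) c))
    - Sum_any (\<lambda>j::nat. ((-1) powi (int j + n) * (of_int n gchoose j)) *s
        M b (n + k - int j) (M a (m + int j) c))"
proof -
  obtain n1 where n1: "\<forall>i\<ge>n1. F a (- i - 1) b = 0"
      "\<forall>\<^sub>F N in sequentially. \<forall>i\<ge>n1. mode (T N) a i b = 0"
    using F_truncation[OF a b] by blast
  obtain n2 where n2: "\<forall>i\<ge>n2. F b (- i - 1) c = 0"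
      "\<forall>\<^sub>F N in sequentially. \<forall>i\<ge>n2. mode (T N) b i c = 0"
    using F_truncation[OF b c] by blast
  obtain n3 where n3: "\<forall>i\<ge>n3. F a (- i - 1) c = 0"
      "\<forall>\<^sub>F N in sequentially. \<forall>i\<ge>n3. mode (T N) a i c = 0"
    using F_truncation[OF a c] by blast
  \<comment> \<open>Each of the three inner products vanishes from one of these indices on.\<close>
  define J where "J = nat (max (n1 - n) (max (n2 - k) (n3 - m)))"
  have J: "n + int j \<ge> n1" "k + int j \<ge> n2" "m + int j \<ge> n3" if "j \<ge> J" for j
    using that unfolding J_def by auto
  define S1 where "S1 P j = (of_int m gchoose j) *s P (P a (n + int j) b) (m + k - int j) c"
    for P :: "'w \<Rightarrow> int \<Rightarrow> 'w \<Rightarrow> 'w" and j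
  define S2 where "S2 P j = ((-1) ^ j * (of_int n gchoose j)) *s P a (m + n - int j) (P b (k + int j) c)"
    for P :: "'w \<Rightarrow> int \<Rightarrow> 'w \<Rightarrow> 'w" and j
  define S3 where "S3 P j = ((-1) powi (int j + n) * (of_int n gchoose j)) *s
      P b (n + k - int j) (P a (m + int j) c)"
    for P :: "'w \<Rightarrow> int \<Rightarrow> 'w \<Rightarrow> 'w" and j
  \<comment> \<open>The vanishing of products with \<open>0\<close> is needed because truncation only makes the inner product vanish.\<close>
  have finite_sums: "Sum_any (S1 P) = sum (S1 P) {..<J}" "Sum_any (S2 P) = sum (S2 P) {..<J}"
      "Sum_any (S3 P) = sum (S3 P) {..<J}"
    if trunc: "\<forall>i\<ge>n1. P a i b = 0" "\<forall>i\<ge>n2. P b i c = 0" "\<forall>i\<ge>n3. P a i c = 0"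
      and zero: "\<And>i. P a i 0 = 0" "\<And>i. P b i 0 = 0" "\<And>i. P 0 i c = 0" for P
  proof -
    have "S1 P j = 0 \<and> S2 P j = 0 \<and> S3 P j = 0" if "\<not> j < J" for j
      using trunc J[of j] that unfolding S1_def S2_def S3_def by (simp add: zero)
    then have "{j. S1 P j \<noteq> 0} \<subseteq> {..<J}" "{j. S2 P j \<noteq> 0} \<subseteq> {..<J}" "{j. S3 P j \<noteq> 0} \<subseteq> {..<J}"
      by auto
    then show "Sum_any (S1 P) = sum (S1 P) {..<J}" "Sum_any (S2 P) = sum (S2 P) {..<J}"
        "Sum_any (S3 P) = sum (S3 P) {..<J}"
      by (auto intro!: Sum_any.expand_superset)
  qed
  have M: "M u i v = F u (- i - 1) v" for u i v
    unfolding M_def by simp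
  have M_zero: "M u i 0 = 0" "M 0 i u = 0" if "u \<in> total" for u i
    using linear_on_zero[OF F_right[OF that] subspace_0[OF total_subspace]]
      linear_on_zero[OF F_left[OF that] subspace_0[OF total_subspace]]
    unfolding M by auto
  have M_sums: "Sum_any (S1 M) = sum (S1 M) {..<J}" "Sum_any (S2 M) = sum (S2 M) {..<J}"
      "Sum_any (S3 M) = sum (S3 M) {..<J}"
    using n1(1) n2(1) n3(1) M_zero a b c by (intro finite_sums; simp add: M)+
  have conv_mode: "converges (\<lambda>N. mode (T N) (X N) i (Z N)) (M x i z)"
    if "converges X x" "converges Z z" for X Z x z i
    unfolding mode_def M by (rule converges_product[OF that])
  note constants_converge = converges_const[OF a] converges_const[OF b] converges_const[OF c]
  have conv1: "converges (\<lambda>N. sum (S1 (mode (T N))) {..<J}) (sum (S1 M) {..<J})"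
    unfolding S1_def by (intro converges_sum converges_scale conv_mode constants_converge tendsto_const)
  have conv2: "converges (\<lambda>N. sum (S2 (mode (T N))) {..<J}) (sum (S2 M) {..<J})"
    unfolding S2_def by (intro converges_sum converges_scale conv_mode constants_converge tendsto_const)
  have conv3: "converges (\<lambda>N. sum (S3 (mode (T N))) {..<J}) (sum (S3 M) {..<J})"
    unfolding S3_def by (intro converges_sum converges_scale conv_mode constants_converge tendsto_const)
  have "\<forall>\<^sub>F N in sequentially. sum (S1 (mode (T N))) {..<J}
      = sum (S2 (mode (T N))) {..<J} - sum (S3 (mode (T N))) {..<J}"
    using n1(2) n2(2) n3(2) eventually_in_U[OF a] eventually_in_U[OF b] eventually_in_U[OF c]
  proof eventually_elim
    case (elim N)
    have zero: "mode (T N) u i 0 = 0" "mode (T N) 0 i u = 0" if "u \<in> U N" for u i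
      using linear_on_zero[OF Y_linear_right[OF that] subspace_0[OF U_subspace]]
        linear_on_zero[OF Y_linear_left[OF that] subspace_0[OF U_subspace]]
      unfolding mode_def by auto
    have "Sum_any (S1 (mode (T N))) = Sum_any (S2 (mode (T N))) - Sum_any (S3 (mode (T N)))"
      unfolding S1_def S2_def S3_def by (rule vertex_algebra.Borcherds[OF algebra elim(4-6)])
    moreover have "Sum_any (S1 (mode (T N))) = sum (S1 (mode (T N))) {..<J}"
        "Sum_any (S2 (mode (T N))) = sum (S2 (mode (T N))) {..<J}"
        "Sum_any (S3 (mode (T N))) = sum (S3 (mode (T N))) {..<J}"
      using elim zero by (intro finite_sums; simp)+
    ultimately show ?case by simp
  qed
  then have "sum (S1 M) {..<J} = sum (S2 M) {..<J} - sum (S3 M) {..<J}"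
    by (rule converges_unique[OF converges_cong[OF _ conv1] converges_diff[OF conv2 conv3]])
  then show ?thesis
    unfolding M_sums[symmetric] unfolding S1_def S2_def S3_def .
qed

lemma limit_vertex_algebra: "vertex_algebra scale limit"
proof unfold_locales
  show "subspace (underlying limit)" using total_subspace by simp
  show "vacuum limit \<in> underlying limit" using vacuum_in_total by simp
  show "vacuum limit \<noteq> 0"
    using vertex_algebra.vacuum_nonzero[OF algebra, of 0] by simp
next
  fix a k assume "a \<in> underlying limit"
  then show "linear_on scale scale (underlying limit) (underlying limit) (state_field limit a k)"
    using F_right[of a k] F_in_total unfolding linear_on_def by auto
next
  fix v k assume "v \<in> underlying limit"
  then show "linear_on scale scale (underlying limit) (underlying limit) (\<lambda>a. state_field limit a k v)"
    using F_left[of v k] F_in_total unfolding linear_on_def by auto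
next
  fix a v assume "a \<in> underlying limit" "v \<in> underlying limit"
  then show "\<exists>n0. \<forall>n\<ge>n0. mode limit a n v = 0"
    using F_truncation[of a v] by auto
next
  fix a assume "a \<in> underlying limit"
  then have a: "a \<in> total" by simp
  have "\<forall>\<^sub>F N in sequentially. Y N a 0 (vacuum (T 0)) = a"
    using eventually_in_U[OF a]
    by eventually_elim (metis vertex_algebra.creation_constant[OF algebra] same_vacuum)
  then show "state_field limit a 0 (vacuum limit) = a"
    using a vacuum_in_total by (simp add: F_eqI)
next
  fix a and k :: int assume "a \<in> underlying limit" "k < 0"
  then have a: "a \<in> total" by simp
  have "\<forall>\<^sub>F N in sequentially. Y N a k (vacuum (T 0)) = 0"
    using eventually_in_U[OF a]
    by eventually_elim (metis vertex_algebra.creation_regular[OF algebra] same_vacuum \<open>k < 0\<close>)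
  then show "state_field limit a k (vacuum limit) = 0"
    using a vacuum_in_total subspace_0[OF total_subspace] by (simp add: F_eqI)
next
  fix v k assume "v \<in> underlying limit"
  then have v: "v \<in> total" by simp
  have "\<forall>\<^sub>F N in sequentially. Y N (vacuum (T 0)) k v = (if k = 0 then v else 0)"
    using eventually_in_U[OF v]
    by eventually_elim (metis vertex_algebra.vacuum_field[OF algebra] same_vacuum)
  then show "state_field limit (vacuum limit) k v = (if k = 0 then v else 0)"
    using F_eqI[OF vacuum_in_total v, of "if k = 0 then v else 0" k] v subspace_0[OF total_subspace]
    by simp
next
  fix a b c m n k
  assume "a \<in> underlying limit" "b \<in> underlying limit" "c \<in> underlying limit"
  then show "Sum_any (\<lambda>j::nat. (of_int m gchoose j) *s
        mode limit (mode limit a (n + int j) b) (m + k - int j) c)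
    = Sum_any (\<lambda>j::nat. ((-1) ^ j * (of_int n gchoose j)) *s
        mode limit a (m + n - int j) (mode limit b (k + int j) c))
    - Sum_any (\<lambda>j::nat. ((-1) powi (int j + n) * (of_int n gchoose j)) *s
        mode limit b (n + k - int j) (mode limit a (m + int j) c))"
    by (intro limit_Borcherds) simp_all
qed

theorem limit_grading_restricted: "grading_restricted_vertex_algebra scale limit"
proof -
  interpret L: vertex_algebra scale limit by (rule limit_vertex_algebra)
  show ?thesis
  proof unfold_locales
    show "direct_sum_grading scale (underlying limit) (weight_space limit)"
      using total_grading by simp
    show "\<exists>n0. \<forall>n<n0. weight_space limit n = {0}"
      using H_bounded_below by simp
    show "\<exists>B. finite B \<and> span B = weight_space limit n" for n
      using basis_finite basis_span by auto
    show "L0 scale (weight_space limit) (state_field limit v k w)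
          - state_field limit v k (L0 scale (weight_space limit) w)
        = of_int k *s state_field limit v k w
          + state_field limit (L0 scale (weight_space limit) v) k w"
      if "v \<in> underlying limit" "w \<in> underlying limit" for v w k
      using that total_grading by (intro L.L0_commutator_of_weights) (auto intro: F_weight)
  qed
qed

end

section \<open>Transport of structure along injective linear maps\<close>

text \<open>
  A linear injection \<open>g\<close> identifies \<open>V\<close> with its image and carries every linear structure
  on \<open>V\<close> to that image.
\<close>

locale injective_on_subspace =
  source: complex_vector_space s + target: complex_vector_space t
  for s :: "complex \<Rightarrow> 'v::ab_group_add \<Rightarrow> 'v"
    and t :: "complex \<Rightarrow> 'w::ab_group_add \<Rightarrow> 'w" +
  fixes V :: "'v set" and W :: "'w set" and g :: "'v \<Rightarrow> 'w"
  assumes subspace: "source.subspace V"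
    and linear: "linear_on s t V W g"
    and inj: "inj_on g V"
begin

lemma linear_extension:
  obtains h where "Vector_Spaces.linear s t h" "\<And>x. x \<in> V \<Longrightarrow> h x = g x"
  using linear_on_extends_to_linear[OF source.vector_space_axioms target.vector_space_axioms
    linear subspace] by blast

lemma subspace_image:
  assumes "source.subspace H" "H \<subseteq> V"
  shows "target.subspace (g ` H)"
proof -
  obtain h where h: "Vector_Spaces.linear s t h" "\<And>x. x \<in> V \<Longrightarrow> h x = g x"
    using linear_extension by blast
  interpret h: Vector_Spaces.linear s t h by fact
  have "g ` H = h ` H"
    using h(2) assms(2) by (intro image_cong) auto
  then show ?thesis
    using h.subspace_image[OF assms(1)] by simp
qed

lemma g_zero: "g 0 = 0"
  by (rule linear_on_zero[OF linear source.subspace_0[OF subspace]])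

lemma g_eq_0_iff: "x \<in> V \<Longrightarrow> g x = 0 \<longleftrightarrow> x = 0"
  using inj_on_eq_iff[OF inj, of x 0] g_zero source.subspace_0[OF subspace] by simp

text \<open>
  As \<open>g\<close> is injective, \<open>x\<close> and its image have the same support. If it is infinite, both
  sums are \<open>0\<close> by convention.
\<close>

lemma g_Sum_any:
  assumes x: "\<And>i. x i \<in> V"
  shows "g (Sum_any x) = Sum_any (\<lambda>i. g (x i))"
proof -
  have supp: "{i. g (x i) \<noteq> 0} = {i. x i \<noteq> 0}"
    using g_eq_0_iff[OF x] by simp
  show ?thesis
    unfolding Sum_any.expand_set supp
    by (rule linear_on_sum[OF source.vector_space_axioms linear subspace x])
qed

lemma Sum_any_in:
  assumes "\<And>i. x i \<in> V"
  shows "Sum_any x \<in> V"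
  unfolding Sum_any.expand_set by (rule source.subspace_sum[OF subspace assms])

lemma grading_image:
  assumes G: "direct_sum_grading s V H"
  shows "direct_sum_grading t (g ` V) (\<lambda>n. g ` H n)"
  unfolding direct_sum_grading_def
proof (intro conjI allI ballI)
  note sub = source.grading_subset[OF G]
  show "target.subspace (g ` H n)" for n
    by (rule subspace_image[OF source.grading_subspace[OF G] sub])
  show "g ` H n \<subseteq> g ` V" for n
    using sub by blast
  fix y assume "y \<in> g ` V"
  then obtain v where v: "v \<in> V" "y = g v" by blast
  have dec_iff: "homogeneous_decomposition (\<lambda>n. g ` H n) (\<lambda>n. g (u n)) y \<longleftrightarrow>
      homogeneous_decomposition H u v" if u: "\<And>n. u n \<in> H n" for u
  proof -
    have uV: "u n \<in> V" for n using u sub by blast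
    have "y = Sum_any (\<lambda>n. g (u n)) \<longleftrightarrow> v = Sum_any u"
      using g_Sum_any[of u, OF uV] inj_on_eq_iff[OF inj v(1) Sum_any_in[of u, OF uV]] v(2) by simp
    then show ?thesis
      unfolding homogeneous_decomposition_def using u g_eq_0_iff[OF uV] by simp
  qed
  obtain u where u: "homogeneous_decomposition H u v"
    using source.grading_decomposition[OF G v(1)] by blast
  show "\<exists>!u'. homogeneous_decomposition (\<lambda>n. g ` H n) u' y"
  proof (rule ex1I)
    show "homogeneous_decomposition (\<lambda>n. g ` H n) (\<lambda>n. g (u n)) y"
      using u dec_iff[of u] unfolding homogeneous_decomposition_def by blast
    fix u' assume u': "homogeneous_decomposition (\<lambda>n. g ` H n) u' y"
    then have "\<forall>n. \<exists>x. x \<in> H n \<and> u' n = g x"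
      unfolding homogeneous_decomposition_def by blast
    then obtain x where x: "\<And>n. x n \<in> H n" "\<And>n. u' n = g (x n)" by metis
    then have "u' = (\<lambda>n. g (x n))" by blast
    then have "homogeneous_decomposition H x v"
      using dec_iff[OF x(1)] u' by simp
    then have "x = u"
      using source.grading_decomposition_unique[OF G v(1)] u by blast
    then show "u' = (\<lambda>n. g (u n))" using x(2) by blast
  qed
qed

text \<open>
  The product on the image is described by its values on vectors \<open>g u\<close> and \<open>g v\<close>, which
  determine it there and avoid an inverse of \<open>g\<close>.
\<close>

lemma vertex_algebra_image:
  assumes A: "vertex_algebra s A" and V: "underlying A = V"
    and B: "underlying B = g ` V" "vacuum B = g (vacuum A)"
    and B_field: "\<And>u v k. u \<in> V \<Longrightarrow> v \<in> V \<Longrightarrow> state_field B (g u) k (g v) = g (state_field A u k v)"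
  shows "vertex_algebra t B"
proof -
  interpret A: vertex_algebra s A by fact
  note gs = linear_on_add[OF linear] linear_on_scale[OF linear]
  have endo: "linear_on s s V V (state_field A a k)" if "a \<in> V" for a k
    using A.state_field_endo that unfolding V by blast
  have lin: "linear_on s s V V (\<lambda>a. state_field A a k v)" if "v \<in> V" for v k
    using A.state_field_linear that unfolding V by blast
  have in_V: "state_field A a k v \<in> V" if "a \<in> V" "v \<in> V" for a k v
    using linear_on_in[OF endo] that .
  have mode_B: "mode B (g a) n (g v) = g (mode A a n v)" if "a \<in> V" "v \<in> V" for a n v
    unfolding mode_def using B_field that .
  have mode_in_V: "mode A a n v \<in> V" if "a \<in> V" "v \<in> V" for a n v
    unfolding mode_def using in_V that .
  show ?thesis
  proof unfold_locales
    show "target.subspace (underlying B)"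
      unfolding B by (rule subspace_image[OF subspace order_refl])
    show "vacuum B \<in> underlying B"
      using A.vacuum_in unfolding B V by blast
    show "vacuum B \<noteq> 0"
      using A.vacuum_nonzero A.vacuum_in g_eq_0_iff unfolding B V by simp
  next
    fix a k assume "a \<in> underlying B"
    then obtain a' where a: "a' \<in> V" "a = g a'" unfolding B by blast
    show "linear_on t t (underlying B) (underlying B) (state_field B a k)"
      unfolding linear_on_def B a(2) using a(1) subspace
      by (auto simp: B_field in_V linear_on_add[OF endo] linear_on_scale[OF endo]
        source.subspace_add source.subspace_scale simp flip: gs)
  next
    fix v k assume "v \<in> underlying B"
    then obtain v' where v: "v' \<in> V" "v = g v'" unfolding B by blast
    show "linear_on t t (underlying B) (underlying B) (\<lambda>a. state_field B a k v)"
      unfolding linear_on_def B v(2) using v(1) subspace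
      by (auto simp: B_field in_V linear_on_add[OF lin] linear_on_scale[OF lin]
        source.subspace_add source.subspace_scale simp flip: gs)
  next
    fix a v assume "a \<in> underlying B" "v \<in> underlying B"
    then obtain a' v' where av: "a' \<in> V" "a = g a'" "v' \<in> V" "v = g v'" unfolding B by blast
    then obtain n0 where "\<forall>n\<ge>n0. mode A a' n v' = 0"
      using A.truncation unfolding V by blast
    then show "\<exists>n0. \<forall>n\<ge>n0. mode B a n v = 0"
      using av by (auto simp: mode_B g_zero intro!: exI[of _ n0])
  next
    fix a assume "a \<in> underlying B"
    then show "state_field B a 0 (vacuum B) = a"
      using A.vacuum_in A.creation_constant B_field unfolding B V by auto
  next
    fix a and k :: int assume "a \<in> underlying B" "k < 0"
    then show "state_field B a k (vacuum B) = 0"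
      using A.vacuum_in A.creation_regular[unfolded V] B_field g_zero unfolding B V by auto
  next
    fix v k assume "v \<in> underlying B"
    then show "state_field B (vacuum B) k v = (if k = 0 then v else 0)"
      using A.vacuum_in A.vacuum_field[unfolded V] B_field g_zero unfolding B V by auto
  next
    fix a b c m n k
    assume "a \<in> underlying B" "b \<in> underlying B" "c \<in> underlying B"
    then obtain a' b' c' where abc: "a' \<in> V" "b' \<in> V" "c' \<in> V" "a = g a'" "b = g b'" "c = g c'"
      unfolding B by blast
    note in_simps = mode_in_V source.subspace_scale[OF subspace] abc(1-3)
    have push: "Sum_any (\<lambda>j. t (r j) (g (x j))) = g (Sum_any (\<lambda>j. s (r j) (x j)))"
      if "\<And>j. x j \<in> V" for r :: "nat \<Rightarrow> complex" and x
      using that by (subst g_Sum_any) (auto simp: gs source.subspace_scale[OF subspace])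
    have "g (Sum_any (\<lambda>j::nat. s (of_int m gchoose j)
            (mode A (mode A a' (n + int j) b') (m + k - int j) c')))
      = g (Sum_any (\<lambda>j::nat. s ((-1) ^ j * (of_int n gchoose j))
            (mode A a' (m + n - int j) (mode A b' (k + int j) c'))))
        - g (Sum_any (\<lambda>j::nat. s ((-1) powi (int j + n) * (of_int n gchoose j))
            (mode A b' (n + k - int j) (mode A a' (m + int j) c'))))"
      unfolding A.Borcherds[unfolded V, OF abc(1-3)]
      by (rule linear_on_diff[OF source.vector_space_axioms linear subspace])
        (intro Sum_any_in in_simps)+
    then show "Sum_any (\<lambda>j::nat. t (of_int m gchoose j)
            (mode B (mode B a (n + int j) b) (m + k - int j) c))
      = Sum_any (\<lambda>j::nat. t ((-1) ^ j * (of_int n gchoose j))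
            (mode B a (m + n - int j) (mode B b (k + int j) c)))
        - Sum_any (\<lambda>j::nat. t ((-1) powi (int j + n) * (of_int n gchoose j))
            (mode B b (n + k - int j) (mode B a (m + int j) c)))"
      unfolding abc(4-6) by (simp add: mode_B in_simps push)
  qed
qed

lemma basis_image:
  assumes ind: "source.independent B" and sub: "source.span B \<subseteq> V"
  shows "target.independent (g ` B)" "target.span (g ` B) = g ` source.span B"
proof -
  obtain h where h: "Vector_Spaces.linear s t h" "\<And>x. x \<in> V \<Longrightarrow> h x = g x"
    using linear_extension by blast
  interpret h: Vector_Spaces.linear s t h by fact
  have eq: "h ` B = g ` B" "h ` source.span B = g ` source.span B"
    using h(2) sub source.span_superset[of B] by (intro image_cong; auto)+
  have "inj_on h (source.span B)"
    using inj_on_subset[OF inj sub] inj_on_cong[of "source.span B" h g] h(2) sub by auto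
  then show "target.independent (g ` B)"
    using h.independent_injective_image[OF ind] eq by simp
  show "target.span (g ` B) = g ` source.span B"
    using h.span_image[of B] eq by simp
qed

text \<open>
  The coordinates of \<open>g x\<close> in the basis \<open>g ` B\<close> are those of \<open>x\<close> in \<open>B\<close>. The
  hypotheses on independence and span concern the image, because for the structure constants the
  basis is given in the limit and \<open>B\<close> consists of its representatives.
\<close>

lemma representation_image:
  assumes B: "B \<subseteq> V" "finite B" and ind: "target.independent (g ` B)"
    and x: "x \<in> V" "g x \<in> target.span (g ` B)" and b: "b \<in> B"
  shows "source.representation B x b = target.representation (g ` B) (g x) (g b)"
proof -
  obtain h where h: "Vector_Spaces.linear s t h" "\<And>x. x \<in> V \<Longrightarrow> h x = g x"
    using linear_extension by blast
  interpret h: Vector_Spaces.linear s t h by fact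
  have eq: "h ` B = g ` B"
    using h(2) B by (intro image_cong; auto)
  have injB: "inj_on g B" by (rule inj_on_subset[OF inj B(1)])
  have indB: "source.independent B"
    unfolding source.dependent_def
  proof
    assume "\<exists>a\<in>B. a \<in> source.span (B - {a})"
    then obtain a where a: "a \<in> B" "a \<in> source.span (B - {a})" by blast
    then have "h a \<in> target.span (h ` (B - {a}))"
      unfolding h.span_image by blast
    moreover have "h ` (B - {a}) = g ` (B - {a})"
      using h(2) B(1) by (intro image_cong) auto
    moreover have "g ` (B - {a}) = g ` B - {g a}"
      using inj_on_image_set_diff[OF injB, of B "{a}"] a(1) by simp
    moreover have "h a = g a" "g a \<in> g ` B"
      using h(2) B(1) a(1) by auto
    ultimately show False
      using ind unfolding target.dependent_def by auto
  qed
  have "g x \<in> h ` source.span B"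
    using x(2) eq h.span_image[of B] by simp
  then obtain y where y: "y \<in> source.span B" "g x = h y" by blast
  have "y \<in> V" using y(1) source.span_minimal[OF B(1) subspace] by blast
  then have "x = y" using y(2) h(2) inj x(1) by (simp add: inj_on_eq_iff)
  let ?r = "source.representation B x"
  let ?inv = "the_inv_into B g"
  have "x = (\<Sum>b\<in>B. s (?r b) b)"
    using source.sum_representation_eq[OF indB _ B(2) order_refl] y(1) \<open>x = y\<close> by simp
  then have "h x = h (\<Sum>b\<in>B. s (?r b) b)"
    by simp
  also have "\<dots> = (\<Sum>b\<in>B. t (?r b) (h b))"
    by (simp add: h.sum h.scale)
  also have "\<dots> = (\<Sum>b\<in>B. t (?r (?inv (g b))) (g b))"
    using h(2) B injB by (intro sum.cong) (auto simp: the_inv_into_f_f)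
  also have "\<dots> = (\<Sum>y\<in>g ` B. t (?r (?inv y)) y)"
    using injB by (simp add: sum.reindex)
  finally have "g x = (\<Sum>y\<in>g ` B. t (?r (?inv y)) y)"
    using h(2) x(1) by simp
  then have "target.representation (g ` B) (g x) (g b) = ?r (?inv (g b))"
    using target.representation_sum_scale[OF ind, of "g b" "\<lambda>y. ?r (?inv y)"] B b by simp
  then show ?thesis using injB b by (simp add: the_inv_into_f_f)
qed

end

section \<open>The direct system inside its limit\<close>

locale direct_system_with_limit =
  grading_restricted_direct_system s A f +
  direct_limit s t "\<lambda>N. underlying (A N)" f Vinf \<phi>
  for s :: "complex \<Rightarrow> 'v::ab_group_add \<Rightarrow> 'v"
    and t :: "complex \<Rightarrow> 'w::ab_group_add \<Rightarrow> 'w"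
    and A :: "nat \<Rightarrow> 'v graded_vertex_structure"
    and f :: "nat \<Rightarrow> nat \<Rightarrow> 'v \<Rightarrow> 'v"
    and Vinf :: "'w set"
    and \<phi> :: "nat \<Rightarrow> 'v \<Rightarrow> 'w"
begin

abbreviation V :: "nat \<Rightarrow> 'v set" where
  "V N \<equiv> underlying (A N)"

abbreviation V_weight :: "nat \<Rightarrow> int \<Rightarrow> 'v set" where
  "V_weight N \<equiv> weight_space (A N)"

abbreviation rep :: "nat \<Rightarrow> 'w \<Rightarrow> 'v" where
  "rep \<equiv> representative A \<phi>"

lemma V_vertex_algebra: "vertex_algebra s (A N)"
  using algebras[of N] unfolding grading_restricted_vertex_algebra_def by blast

lemma V_grading: "direct_sum_grading s (V N) (V_weight N)"
  by (rule grading_restricted_vertex_algebra.grading[OF algebras])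

lemma V_weight_subset: "V_weight N n \<subseteq> V N"
  using V_grading unfolding direct_sum_grading_def by blast

lemma V_subspace: "subspace (V N)"
  by (rule vertex_algebra.subspace_underlying[OF V_vertex_algebra])

lemma canonical_inj: "inj_on (\<phi> N) (V N)"
proof (rule inj_onI)
  fix x y assume xy: "x \<in> V N" "y \<in> V N" "\<phi> N x = \<phi> N y"
  then obtain K where "K \<ge> N" "f N K x = f N K y"
    using canonical_eq[OF xy] by auto
  then show "x = y"
    using f_inj[of N K] xy(1,2) by (simp add: inj_on_eq_iff)
qed

lemma rep_canonical: "x \<in> V N \<Longrightarrow> rep N (\<phi> N x) = x"
  unfolding representative_def by (intro the_equality) (auto dest: inj_onD[OF canonical_inj])

sublocale canonical: injective_on_subspace s t "V N" Vinf "\<phi> N" for N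
  by unfold_locales (rule V_subspace canonical_linear canonical_inj)+

text \<open>
  The target index \<open>max M N\<close> stands for an arbitrary index above \<open>M\<close>, so that no side condition
  \<open>M \<le> N\<close> is attached to the interpretation.
\<close>

sublocale transition: injective_on_subspace s s "V M" "V (max M N)" "f M (max M N)" for M N
  by unfold_locales (rule V_subspace f_linear[OF max.cobounded1] f_inj[OF max.cobounded1])+

lemma canonical_weight_mono:
  assumes "M \<le> N"
  shows "\<phi> M ` V_weight M n \<subseteq> \<phi> N ` V_weight N n"
proof
  fix y assume "y \<in> \<phi> M ` V_weight M n"
  then obtain x where x: "x \<in> V_weight M n" "y = \<phi> M x" by blast
  then have "x \<in> V M" using V_weight_subset by blast
  then have "y = \<phi> N (f M N x)"
    using canonical_compatible[OF assms] x(2) by simp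
  moreover have "f M N x \<in> V_weight N n"
    using f_grading[OF assms] x(1) by blast
  ultimately show "y \<in> \<phi> N ` V_weight N n" by blast
qed

text \<open>
  The transition map sends the \<open>n\<close>-th weight space injectively into a space of the same finite
  dimension, hence onto it.
\<close>

lemma saturated_weight_space:
  assumes sat: "saturated s A M n" and "M \<le> N"
  shows "\<phi> N ` V_weight N n = \<phi> M ` V_weight M n"
proof -
  obtain B where B: "finite B" "independent B" "span B = V_weight M n"
    by (rule grading_restricted_vertex_algebra.weight_space_basis[OF algebras])
  obtain D where D: "finite D" "independent D" "span D = V_weight N n"
    by (rule grading_restricted_vertex_algebra.weight_space_basis[OF algebras])
  have BV: "span B \<subseteq> V M" using B(3) V_weight_subset by simp
  have N: "max M N = N" using \<open>M \<le> N\<close> by simp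
  note image = transition.basis_image[OF B(2) BV, of N, unfolded N B(3)]
  have "dim (V_weight M n) = dim (V_weight N n)"
    using sat \<open>M \<le> N\<close> unfolding saturated_def by blast
  then have "card B = card D"
    using dim_span_eq_card_independent[OF B(2)] dim_span_eq_card_independent[OF D(2)] B(3) D(3) by simp
  moreover have "B \<subseteq> V M" using BV span_superset by blast
  then have "card (f M N ` B) = card B"
    using f_inj[OF \<open>M \<le> N\<close>] by (intro card_image) (rule inj_on_subset)
  moreover have "f M N ` B \<subseteq> span D"
    using f_grading[OF \<open>M \<le> N\<close>, of n] span_superset[of B] B(3) D(3) by blast
  ultimately have "span (f M N ` B) = span D"
    using independent_full_cardinality_spans[OF D(1,2) image(1)] by simp
  then have "V_weight N n = f M N ` V_weight M n"
    using image(2) D(3) by simp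
  then have "\<phi> N ` V_weight N n = (\<lambda>x. \<phi> N (f M N x)) ` V_weight M n"
    by (simp add: image_image)
  also have "\<dots> = \<phi> M ` V_weight M n"
    using canonical_compatible[OF \<open>M \<le> N\<close>] V_weight_subset by (intro image_cong) auto
  finally show ?thesis .
qed

text \<open>
  The algebra \<open>V\<^sup>N\<close> carried to its image in the limit. In this form the transition maps become
  inclusions of subspaces.
\<close>

definition T :: "nat \<Rightarrow> 'w graded_vertex_structure" where
  "T N = \<lparr>underlying = \<phi> N ` V N,
     vacuum = \<phi> N (vacuum (A N)),
     state_field = (\<lambda>u k v. \<phi> N (state_field (A N) (rep N u) k (rep N v))),
     weight_space = (\<lambda>n. \<phi> N ` V_weight N n)\<rparr>"

lemma T_simps [simp]:
  "underlying (T N) = \<phi> N ` V N"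
  "vacuum (T N) = \<phi> N (vacuum (A N))"
  "state_field (T N) u k v = \<phi> N (state_field (A N) (rep N u) k (rep N v))"
  "weight_space (T N) n = \<phi> N ` V_weight N n"
  unfolding T_def by simp_all

lemma canonical_vacuum: "\<phi> N (vacuum (A N)) = \<phi> M (vacuum (A M))"
proof -
  have "\<phi> K (vacuum (A K)) = \<phi> 0 (vacuum (A 0))" for K
    using canonical_compatible[of 0 K "vacuum (A 0)"] f_vacuum[of 0 K]
      vertex_algebra.vacuum_in[OF V_vertex_algebra] by simp
  then show ?thesis by metis
qed

sublocale stage: stabilizing_vertex_algebras t T
proof (intro stabilizing_vertex_algebras.intro stabilizing_vertex_algebras_axioms.intro)
  \<comment> \<open>Only the outermost predicates are unfolded: being a vertex algebra is inherited as a whole.\<close>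
  show "complex_vector_space t" ..
  show "vertex_algebra t (T N)" for N
    by (rule canonical.vertex_algebra_image[OF V_vertex_algebra[of N] refl])
      (simp_all add: rep_canonical)
  show "direct_sum_grading t (underlying (T N)) (weight_space (T N))" for N
    using canonical.grading_image[OF V_grading] unfolding T_def by simp
  show "state_field (T N) u k v \<in> weight_space (T N) (p + q + k)"
    if "u \<in> weight_space (T N) p" "v \<in> weight_space (T N) q" for N u v p q k
    using that grading_restricted_vertex_algebra.state_field_weight[OF algebras]
      V_weight_subset by (auto simp: rep_canonical subset_iff)
  show "weight_space (T M) n \<subseteq> weight_space (T N) n" if "M \<le> N" for M N n
    using canonical_weight_mono[OF that] by simp
  show "vacuum (T N) = vacuum (T 0)" for N
    using canonical_vacuum by simp
  show "\<exists>K. \<forall>N\<ge>K. weight_space (T N) n = weight_space (T K) n" for n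
  proof -
    obtain K where "\<forall>M\<ge>K. \<forall>N\<ge>K. dim (V_weight M n) = dim (V_weight N n)"
      using dim_stable by blast
    then have sat: "saturated s A K n" unfolding saturated_def by blast
    have "weight_space (T N) n = weight_space (T K) n" if "K \<le> N" for N
      using saturated_weight_space[OF sat that] by simp
    then show ?thesis by blast
  qed
  show "\<exists>nbar. \<forall>\<^sub>F N in sequentially. \<forall>n<nbar. weight_space (T N) n = {0}"
  proof -
    obtain nbar K where "\<forall>N\<ge>K. \<forall>n<nbar. V_weight N n = {0}"
      using uniformly_bounded_below by blast
    then have "\<forall>N\<ge>K. \<forall>n<nbar. weight_space (T N) n = {0}"
      by (simp add: canonical.g_zero)
    then show ?thesis unfolding eventually_sequentially by blast
  qed
qed

lemma stage_total: "stage.total = Vinf"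
  unfolding stage.total_def canonical_covers by simp

lemma stage_H: "stage.H = limit_weight_space A \<phi>"
  unfolding stage.H_def limit_weight_space_def by auto

end

locale direct_system_with_basis = direct_system_with_limit s t A f Vinf \<phi>
  for s :: "complex \<Rightarrow> 'v::ab_group_add \<Rightarrow> 'v"
    and t :: "complex \<Rightarrow> 'w::ab_group_add \<Rightarrow> 'w"
    and A :: "nat \<Rightarrow> 'v graded_vertex_structure"
    and f :: "nat \<Rightarrow> nat \<Rightarrow> 'v \<Rightarrow> 'v"
    and Vinf :: "'w set"
    and \<phi> :: "nat \<Rightarrow> 'v \<Rightarrow> 'w" +
  fixes \<Phi> :: "int \<Rightarrow> 'w set"
  assumes limit_basis: "homogeneous_limit_basis s A \<phi> \<Phi>"
    and structure_constants_converge: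
      "a \<in> (\<Union>n. \<Phi> n) \<Longrightarrow> b \<in> (\<Union>n. \<Phi> n) \<Longrightarrow> c \<in> (\<Union>n. \<Phi> n) \<Longrightarrow>
        convergent (\<lambda>N. structure_constant s A \<phi> \<Phi> N a b c)"
begin

text \<open>
  The basis is the image of a basis of a saturated weight space, and the image of a saturated
  weight space is the whole weight space of the limit.
\<close>

lemma weight_basis:
  "target.independent (\<Phi> n)" "finite (\<Phi> n)" "target.span (\<Phi> n) = stage.H n"
proof -
  obtain M B where sat: "saturated s A M n" and B: "independent B" "span B = V_weight M n"
    and \<Phi>: "\<Phi> n = \<phi> M ` B"
    using limit_basis unfolding homogeneous_limit_basis_def by blast
  note image = canonical.basis_image[of B M, folded \<Phi>, unfolded B(2), OF B(1) V_weight_subset]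
  show "target.independent (\<Phi> n)" by (rule image(1))
  obtain D where "finite D" "independent D" "span D = V_weight M n"
    by (rule grading_restricted_vertex_algebra.weight_space_basis[OF algebras])
  then have "finite B"
    using independent_span_bound[of D B] B span_superset[of B] by simp
  then show "finite (\<Phi> n)" using \<Phi> by simp
  have "\<phi> N ` V_weight N n \<subseteq> \<phi> M ` V_weight M n" for N
    using canonical_weight_mono[of N "max M N" n] saturated_weight_space[OF sat, of "max M N"] by simp
  then have "stage.H n = \<phi> M ` V_weight M n"
    unfolding stage.H_def by auto
  then show "target.span (\<Phi> n) = stage.H n" using image(2) by simp
qed

lemma basis_in_H: "\<Phi> n \<subseteq> stage.H n"
  using weight_basis(3) target.span_superset by blast

lemma basis_weight:
  assumes "a \<in> \<Phi> n"
  shows "wt (limit_weight_space A \<phi>) a = n"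
proof -
  have "a \<noteq> 0" using assms weight_basis(1) target.dependent_zero by blast
  then show ?thesis
    unfolding wt_def stage_H[symmetric]
    using assms basis_in_H canonical.target.weight_unique[OF stage.total_grading stage.total_subspace]
    by (intro the_equality) blast+
qed

lemma basis_of_weight: "{a \<in> (\<Union>n. \<Phi> n). wt (limit_weight_space A \<phi>) a = n} = \<Phi> n"
  using basis_weight by auto

text \<open>
  From some \<open>N\<close> on, \<open>b\<close> and \<open>c\<close> have representatives and the weight space of \<open>a\<close> is all
  of the limit weight space. The map \<open>\<phi> N\<close> then carries the basis of representatives to
  \<open>\<Phi> (p + q + k)\<close> and so identifies the two systems of coordinates. The mode index
  \<open>wt c + wt b - wt a - 1\<close> is the one that belongs to the power \<open>z\<^sup>k\<close>.
\<close>

lemma structure_constant_eventually: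
  assumes a: "a \<in> \<Phi> (p + q + k)" and b: "b \<in> \<Phi> p" and c: "c \<in> \<Phi> q"
  shows "\<forall>\<^sub>F N in sequentially. structure_constant s A \<phi> \<Phi> N a b c
    = target.representation (\<Phi> (p + q + k)) (state_field (T N) b k c) a"
  using stage.eventually_weight_space[of p] stage.eventually_weight_space[of q]
    stage.eventually_weight_space[of "p + q + k"]
proof eventually_elim
  case (elim N)
  note elim = elim[unfolded T_simps]
  let ?n = "p + q + k"
  let ?B = "rep N ` \<Phi> ?n"
  let ?x = "state_field (A N) (rep N b) k (rep N c)"
  have in_V: "rep N y \<in> V_weight N m \<and> \<phi> N (rep N y) = y" if "y \<in> \<phi> N ` V_weight N m" for y m
    using that V_weight_subset by (auto simp: rep_canonical subset_iff)
  have reps: "rep N b \<in> V_weight N p" "rep N c \<in> V_weight N q"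
    using in_V[of b p] in_V[of c q] b c basis_in_H[of p] basis_in_H[of q] elim by blast+
  have \<Phi>: "rep N y \<in> V_weight N ?n \<and> \<phi> N (rep N y) = y" if "y \<in> \<Phi> ?n" for y
    using in_V[of y ?n] that basis_in_H[of ?n] elim(3) by blast
  have B: "?B \<subseteq> V N" "finite ?B" "\<phi> N ` ?B = \<Phi> ?n" "rep N a \<in> ?B"
    using \<Phi> V_weight_subset weight_basis(2) a by (auto simp: image_image)
  have x: "?x \<in> V_weight N ?n"
    by (rule grading_restricted_vertex_algebra.state_field_weight[OF algebras reps])
  then have "\<phi> N ?x \<in> target.span (\<phi> N ` ?B)"
    using elim(3) B(3) weight_basis(3) by auto
  then have "representation ?B ?x (rep N a)
      = target.representation (\<phi> N ` ?B) (\<phi> N ?x) (\<phi> N (rep N a))"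
    using x V_weight_subset weight_basis(1) B
    by (intro canonical.representation_image) auto
  then show ?case
    using \<Phi>[OF a] B(3)
    by (simp add: structure_constant_def Let_def basis_weight[OF a] basis_weight[OF b] basis_weight[OF c]
      mode_def algebra_simps)
qed

abbreviation field :: "'w \<Rightarrow> int \<Rightarrow> 'w \<Rightarrow> 'w" where
  "field \<equiv> limit_field s t A \<phi> \<Phi>"

sublocale pair: vector_space_pair t t ..

lemma basis_union_independent: "target.independent (\<Union>n. \<Phi> n)"
  by (rule canonical.target.independent_Union_of_weights[OF stage.total_grading stage.total_subspace
    weight_basis(1) basis_in_H])

lemma field_linear_left: "linear_on t t W UNIV (\<lambda>u. field u k v)"
proof -
  interpret c: Vector_Spaces.linear t t "pair.construct (\<Union>n. \<Phi> n) g" for g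
    by (rule pair.linear_construct[OF basis_union_independent])
  show ?thesis
    unfolding limit_field_def linear_on_def by (simp add: c.add c.scale)
qed

text \<open>
  The vector \<open>v\<close> enters through the values that the extension in the first argument takes on
  basis vectors, so linearity also uses that an extension depends linearly on these values.
\<close>

lemma field_linear_right: "linear_on t t W UNIV (field u k)"
proof -
  interpret c: Vector_Spaces.linear t t "pair.construct (\<Union>n. \<Phi> n) g" for g
    by (rule pair.linear_construct[OF basis_union_independent])
  show ?thesis
    unfolding limit_field_def linear_on_def
    by (simp add: c.add c.scale pair.construct_add[OF basis_union_independent]
      pair.construct_scale[OF basis_union_independent])
qed

lemma field_basis:
  assumes b: "b \<in> \<Phi> p" and c: "c \<in> \<Phi> q"
  shows "field b k c = (\<Sum>a\<in>\<Phi> (p + q + k). t (limit_structure_constant s A \<phi> \<Phi> a b c) a)"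
proof -
  have "{a \<in> (\<Union>n. \<Phi> n). wt (limit_weight_space A \<phi>) a - p - q = k} = \<Phi> (p + q + k)"
    using basis_of_weight[of "p + q + k"] by (auto simp: algebra_simps)
  moreover have "b \<in> (\<Union>n. \<Phi> n)" "c \<in> (\<Union>n. \<Phi> n)" using b c by auto
  ultimately show ?thesis
    unfolding limit_field_def
    by (simp add: pair.construct_basis[OF basis_union_independent] limit_field_basis_def
      Let_def basis_weight[OF b] basis_weight[OF c])
qed

sublocale convergent_vertex_algebras t T \<Phi> field "limit_structure_constant s A \<phi> \<Phi>"
proof unfold_locales
  show "target.independent (\<Phi> n)" "finite (\<Phi> n)" "target.span (\<Phi> n) = stage.H n" for n
    by (rule weight_basis)+
  show "field b k c = (\<Sum>a\<in>\<Phi> (p + q + k). t (limit_structure_constant s A \<phi> \<Phi> a b c) a)"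
    if "b \<in> \<Phi> p" "c \<in> \<Phi> q" for b c p q k
    by (rule field_basis[OF that])
  show "(\<lambda>N. target.representation (\<Phi> (p + q + k)) (state_field (T N) b k c) a)
      \<longlonglongrightarrow> limit_structure_constant s A \<phi> \<Phi> a b c"
    if abc: "a \<in> \<Phi> (p + q + k)" "b \<in> \<Phi> p" "c \<in> \<Phi> q" for a b c p q k
  proof (rule Lim_transform_eventually[OF _ structure_constant_eventually[OF abc]])
    show "(\<lambda>N. structure_constant s A \<phi> \<Phi> N a b c) \<longlonglongrightarrow> limit_structure_constant s A \<phi> \<Phi> a b c"
      unfolding limit_structure_constant_def using structure_constants_converge[of a b c] abc
      by (auto simp: convergent_LIMSEQ_iff)
  qed
  show "linear_on t t stage.total UNIV (field u k)" for u k
    by (rule field_linear_right)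
  show "linear_on t t stage.total UNIV (\<lambda>u. field u k v)" for v k
    by (rule field_linear_left)
qed

end

section \<open>The limit is a grading-restricted vertex algebra\<close>

theorem theorem2p3:
  fixes s :: "complex \<Rightarrow> 'v::ab_group_add \<Rightarrow> 'v"
    and t :: "complex \<Rightarrow> 'w::ab_group_add \<Rightarrow> 'w"
    and A :: "nat \<Rightarrow> 'v graded_vertex_structure"
    and f :: "nat \<Rightarrow> nat \<Rightarrow> 'v \<Rightarrow> 'v"
    and Vinf :: "'w set"
    and \<phi> :: "nat \<Rightarrow> 'v \<Rightarrow> 'w"
    and \<Phi> :: "int \<Rightarrow> 'w set"
    and N\<^sub>0 :: nat
  assumes "grading_restricted_direct_system s A f"
    and "direct_limit s t (\<lambda>N. underlying (A N)) f Vinf \<phi>"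
    and "homogeneous_limit_basis s A \<phi> \<Phi>"
    and "\<And>a b c. a \<in> (\<Union>n. \<Phi> n) \<Longrightarrow> b \<in> (\<Union>n. \<Phi> n) \<Longrightarrow> c \<in> (\<Union>n. \<Phi> n) \<Longrightarrow>
           convergent (\<lambda>N. structure_constant s A \<phi> \<Phi> N a b c)"
  shows "grading_restricted_vertex_algebra t
           \<lparr>underlying = Vinf,
            vacuum = \<phi> N\<^sub>0 (vacuum (A N\<^sub>0)),
            state_field = limit_field s t A \<phi> \<Phi>,
            weight_space = limit_weight_space A \<phi>\<rparr>"
proof -
  interpret grading_restricted_direct_system s A f by fact
  interpret direct_limit s t "\<lambda>N. underlying (A N)" f Vinf \<phi> by fact
  interpret direct_system_with_basis s t A f Vinf \<phi> \<Phi>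
    by unfold_locales (rule assms; assumption)+
  show ?thesis
    using limit_grading_restricted canonical_vacuum[of 0 N\<^sub>0]
    unfolding limit_def stage_total stage_H by simp
qed

end
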